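(* Let $n\ge 2$ and $q=2^n$. Let $h(y)=y^{q/2}+y^{q/4}+\dots+y^2+y\in\mathbb{F}_{q^2}[y]$ and let $Y_2=\mathbb{F}_{q^2}(x,y)$ be the function field over $\mathbb{F}_{q^2}$ defined by $h(y)=x^{q+1}$. Let $P_\infty$ be the unique common pole of $x$ and $y$ in $Y_2$. Then every $\mathbb{F}_{q^2}$-automorphism of $Y_2$ fixes $P_\infty$, i.e. $$\mathrm{Aut}(Y_2/\mathbb{F}_{q^2})=G(P_\infty):=\{\sigma\in \mathrm{Aut}(Y_2/\mathbb{F}_{q^2}) : \sigma(P_\infty)=P_\infty\}.$$
   Context: $\mathrm{Aut}(Y_2/\mathbb{F}_{q^2})$ denotes the group of field automorphisms of $Y_2$ fixing $\mathbb{F}_{q^2}$ elementwise; it acts on the set of places of $Y_2$ by $\sigma(P)=\{\sigma(z):z\in P\}$. The place $P_\infty$ is the unique place of $Y_2$ lying over the pole of $x$ in $\mathbb{F}_{q^2}(x)$, and it is rational. *)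

theory Defs
  imports "HOL-Computational_Algebra.Polynomial"
begin

text \<open>The function field is the whole type \<open>'a\<close>; its constant field is a subset \<open>K\<close> of it.\<close>

definition is_subring :: "'a::field set \<Rightarrow> bool" where
  "is_subring R \<longleftrightarrow> 1 \<in> R \<and> (\<forall>a\<in>R. \<forall>b\<in>R. a - b \<in> R \<and> a * b \<in> R)"

definition is_subfield :: "'a::field set \<Rightarrow> bool" where
  "is_subfield K \<longleftrightarrow> is_subring K \<and> (\<forall>a\<in>K. inverse a \<in> K)"

definition field_adjoin :: "'a::field set \<Rightarrow> 'a set \<Rightarrow> 'a set" where
  "field_adjoin K S = \<Inter>{L. is_subfield L \<and> K \<subseteq> L \<and> S \<subseteq> L}"

definition transcendental_over :: "'a::field set \<Rightarrow> 'a \<Rightarrow> bool" where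
  "transcendental_over K x \<longleftrightarrow>
     (\<forall>p. (\<forall>i. coeff p i \<in> K) \<longrightarrow> p \<noteq> 0 \<longrightarrow> poly p x \<noteq> 0)"

definition is_ideal_of :: "'a::field set \<Rightarrow> 'a set \<Rightarrow> bool" where
  "is_ideal_of R I \<longleftrightarrow> I \<subseteq> R \<and> 0 \<in> I \<and>
     (\<forall>a\<in>I. \<forall>b\<in>I. a - b \<in> I) \<and> (\<forall>r\<in>R. \<forall>a\<in>I. r * a \<in> I)"

definition is_maximal_ideal_of :: "'a::field set \<Rightarrow> 'a set \<Rightarrow> bool" where
  "is_maximal_ideal_of R M \<longleftrightarrow> is_ideal_of R M \<and> M \<noteq> R \<and>
     (\<forall>J. is_ideal_of R J \<longrightarrow> M \<subseteq> J \<longrightarrow> J = M \<or> J = R)"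

definition is_valuation_ring :: "'a::field set \<Rightarrow> 'a set \<Rightarrow> bool" where
  "is_valuation_ring K R \<longleftrightarrow> is_subring R \<and> K \<subset> R \<and> R \<subset> UNIV \<and>
     (\<forall>z. z \<in> R \<or> inverse z \<in> R)"

definition is_place :: "'a::field set \<Rightarrow> 'a set \<Rightarrow> bool" where
  "is_place K P \<longleftrightarrow> (\<exists>R. is_valuation_ring K R \<and> is_maximal_ideal_of R P)"

text \<open>A place \<open>P\<close> determines its valuation ring, as the set of all \<open>z\<close> with \<open>z = 0\<close> or
  \<open>inverse z \<notin> P\<close>, so the existential quantifier below ranges over a single ring. It
  includes that \<open>P\<close> is a place.\<close>

definition is_pole_of :: "'a::field set \<Rightarrow> 'a set \<Rightarrow> 'a \<Rightarrow> bool" where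
  "is_pole_of K P z \<longleftrightarrow> (\<exists>R. is_valuation_ring K R \<and> is_maximal_ideal_of R P \<and> z \<notin> R)"

definition field_aut :: "'a::field set \<Rightarrow> ('a \<Rightarrow> 'a) set" where
  "field_aut K = {\<sigma>. bij \<sigma> \<and> (\<forall>a b. \<sigma> (a + b) = \<sigma> a + \<sigma> b) \<and>
     (\<forall>a b. \<sigma> (a * b) = \<sigma> a * \<sigma> b) \<and> (\<forall>c\<in>K. \<sigma> c = c)}"

definition place_stabilizer :: "'a::field set \<Rightarrow> 'a set \<Rightarrow> ('a \<Rightarrow> 'a) set" where
  "place_stabilizer K P = {\<sigma> \<in> field_aut K. \<sigma> ` P = P}"

text \<open>\<open>y ^ (q/2) + y ^ (q/4) + ... + y ^ 2 + y\<close> for \<open>q = 2 ^ n\<close>.\<close>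

definition Y2_h :: "nat \<Rightarrow> 'a::field \<Rightarrow> 'a" where
  "Y2_h n y = (\<Sum>i<n. y ^ (2 ^ i))"

text \<open>When \<open>card K = (2 ^ n)\<^sup>2\<close>, the polynomial \<open>Y2_h n T - x ^ (2 ^ n + 1)\<close> is irreducible over
  \<open>K(x)\<close>: its degree \<open>2 ^ (n - 1)\<close> is coprime to \<open>2 ^ n + 1\<close>, so the pole of \<open>x\<close> is totally
  ramified. Hence these conditions determine the field up to isomorphism over \<open>K\<close>.\<close>

definition is_Y2 :: "nat \<Rightarrow> 'a::field set \<Rightarrow> 'a \<Rightarrow> 'a \<Rightarrow> bool" where
  "is_Y2 n K x y \<longleftrightarrow> transcendental_over K x \<and> Y2_h n y = x ^ (2 ^ n + 1) \<and>
     field_adjoin K {x, y} = UNIV"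

end

theory Submission
  imports Defs
begin

text \<open>Put \<open>m = q / 2\<close>, so that \<open>x\<close> and \<open>y\<close> have pole orders \<open>m\<close> and \<open>2 * m + 1\<close> at infinity. Suppose an
  automorphism \<open>\<sigma>\<close> moves the place at infinity to another place. That place is rational, and after a
  change of generators it is the origin, where \<open>x\<close> vanishes and \<open>y\<close> has the divisor
  \<open>2 * m + 1\<close> times (origin minus infinity). The function \<open>\<sigma> x\<close> has a pole of order \<open>m\<close> at the origin
  and no other pole, so \<open>\<sigma> x * y\<close> has a pole at infinity only, of order at most \<open>2 * m + 1\<close>. As
  \<open>K[x, y]\<close> is integrally closed, \<open>\<sigma> x * y = a + b * x + c * x ^ 2 + d * y\<close> with constants \<open>a\<close>, \<open>b\<close>,
  \<open>c\<close>, \<open>d\<close>. The left-hand side is divisible by \<open>x ^ (m + 1)\<close> at the origin and \<open>m + 1 \<ge> 3\<close>, hence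
  \<open>a = b = c = 0\<close> and \<open>\<sigma> x = d\<close> is constant, which is absurd.

  For integral closedness, note that \<open>y\<close> is a polynomial in \<open>y\<^sup>2\<close> over \<open>K[x]\<close>, so that the powers of
  \<open>y ^ 2 ^ e\<close> form a basis of \<open>K[x, y]\<close> over \<open>K[x]\<close> for every \<open>e\<close>. If \<open>z\<close> is integral, some nonzero
  \<open>b\<close> in \<open>K[x]\<close> carries all \<open>z ^ 2 ^ e\<close> into \<open>K[x, y]\<close>, and comparing coordinates shows that \<open>b\<close> times
  the \<open>2 ^ e\<close>-th power of each coordinate of \<open>z\<close> is a polynomial, which forces the coordinates of \<open>z\<close>
  to be polynomials.\<close>

section \<open>Subrings of a field\<close>

lemma subring_one: "is_subring R \<Longrightarrow> 1 \<in> R"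
  and subring_diff: "is_subring R \<Longrightarrow> a \<in> R \<Longrightarrow> b \<in> R \<Longrightarrow> a - b \<in> R"
  and subring_mult: "is_subring R \<Longrightarrow> a \<in> R \<Longrightarrow> b \<in> R \<Longrightarrow> a * b \<in> R"
  by (auto simp: is_subring_def)

lemma subring_zero: "is_subring R \<Longrightarrow> 0 \<in> R"
  using subring_diff[of R 1 1] by (simp add: subring_one)

lemma subring_uminus: "is_subring R \<Longrightarrow> a \<in> R \<Longrightarrow> - a \<in> R"
  using subring_diff[of R 0 a] by (simp add: subring_zero)

lemma subring_add: "is_subring R \<Longrightarrow> a \<in> R \<Longrightarrow> b \<in> R \<Longrightarrow> a + b \<in> R"
  using subring_diff[of R a "- b"] by (simp add: subring_uminus)

lemma subring_power: "is_subring R \<Longrightarrow> a \<in> R \<Longrightarrow> a ^ k \<in> R"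
  by (induction k) (auto simp: subring_one subring_mult)

lemma subring_sum: "is_subring R \<Longrightarrow> (\<And>i. i \<in> I \<Longrightarrow> f i \<in> R) \<Longrightarrow> sum f I \<in> R"
  by (induction I rule: infinite_finite_induct) (auto simp: subring_zero subring_add)

lemmas subring_closed = subring_one subring_zero subring_diff subring_mult subring_uminus
  subring_add subring_power subring_sum

lemma subfield_subring: "is_subfield L \<Longrightarrow> is_subring L"
  and subfield_inverse: "is_subfield L \<Longrightarrow> a \<in> L \<Longrightarrow> inverse a \<in> L"
  by (auto simp: is_subfield_def)

lemma subfield_divide: "is_subfield L \<Longrightarrow> a \<in> L \<Longrightarrow> b \<in> L \<Longrightarrow> a / b \<in> L"
  by (simp add: divide_inverse subfield_subring subring_mult subfield_inverse)

definition poly_ring :: "'a::field set \<Rightarrow> 'a \<Rightarrow> 'a set" where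
  "poly_ring R w = {poly p w | p. \<forall>i. coeff p i \<in> R}"

lemma poly_ring_subring:
  assumes "is_subring R"
  shows "is_subring (poly_ring R w)"
  unfolding is_subring_def
proof (intro conjI ballI)
  show "1 \<in> poly_ring R w"
    unfolding poly_ring_def
    by (rule CollectI, rule exI[of _ 1]) (auto simp: coeff_1 subring_closed[OF assms])
  fix a b assume "a \<in> poly_ring R w" "b \<in> poly_ring R w"
  then obtain p r where pr: "a = poly p w" "b = poly r w"
    "\<And>i. coeff p i \<in> R" "\<And>i. coeff r i \<in> R"
    unfolding poly_ring_def by blast
  show "a - b \<in> poly_ring R w"
    unfolding poly_ring_def
    by (rule CollectI, rule exI[of _ "p - r"]) (auto simp: pr subring_diff[OF assms])
  show "a * b \<in> poly_ring R w"
    unfolding poly_ring_def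
    by (rule CollectI, rule exI[of _ "p * r"])
      (auto simp: pr coeff_mult intro!: subring_sum[OF assms] subring_mult[OF assms])
qed

lemma poly_ring_base: "is_subring R \<Longrightarrow> R \<subseteq> poly_ring R w"
proof
  fix a assume "is_subring R" "a \<in> R"
  then show "a \<in> poly_ring R w"
    unfolding poly_ring_def
    by (intro CollectI exI[of _ "[:a:]"]) (auto simp: coeff_pCons subring_zero split: nat.split)
qed

lemma poly_ring_gen: "is_subring R \<Longrightarrow> w \<in> poly_ring R w"
  unfolding poly_ring_def
  by (intro CollectI exI[of _ "[:0, 1:]"])
    (auto simp: coeff_pCons subring_zero subring_one split: nat.split)

lemma poly_ring_sum:
  assumes "a \<in> poly_ring R w"
  obtains c N where "\<And>i. c i \<in> R" "a = (\<Sum>i\<le>(N::nat). c i * w ^ i)"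
  using assms unfolding poly_ring_def by (auto simp: poly_altdef)

section \<open>Valuation rings\<close>

locale valuation_subring =
  fixes R :: "'a::field set"
  assumes subring: "is_subring R"
    and total: "\<And>z. z \<in> R \<or> inverse z \<in> R"
begin

text \<open>The nonunits of \<open>R\<close>. Membership in \<open>R\<close> follows from
  \<open>total\<close>; zero is listed separately because \<open>inverse 0 = 0\<close> lies in
  \<open>R\<close>.\<close>

definition mx :: "'a set" where
  "mx = {z. z = 0 \<or> inverse z \<notin> R}"

lemma mx_subset: "z \<in> mx \<Longrightarrow> z \<in> R"
  using total[of z] subring_zero[OF subring] by (auto simp: mx_def)

lemma zero_mx [simp]: "0 \<in> mx"
  by (simp add: mx_def)

lemma one_not_mx: "1 \<notin> mx"
  by (simp add: mx_def subring_one[OF subring])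

lemma not_in_iff: "z \<notin> R \<longleftrightarrow> z \<noteq> 0 \<and> inverse z \<in> mx"
  using subring_zero[OF subring] by (auto simp: mx_def)

lemma mx_mult:
  assumes "a \<in> R" "z \<in> mx"
  shows "a * z \<in> mx"
proof (cases "a * z = 0")
  case False
  have "inverse (a * z) \<notin> R"
  proof
    assume "inverse (a * z) \<in> R"
    then have "a * inverse (a * z) \<in> R"
      by (rule subring_mult[OF subring assms(1)])
    then show False
      using False assms(2) by (simp add: mx_def field_simps)
  qed
  then show ?thesis by (simp add: mx_def)
qed auto

lemma mx_uminus: "z \<in> mx \<Longrightarrow> - z \<in> mx"
  using mx_mult[of "-1" z] by (simp add: subring_closed[OF subring])

text \<open>One of \<open>b / a\<close> and \<open>a / b\<close> lies in \<open>R\<close>; taking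
  out its denominator writes the sum as an element of \<open>R\<close> times an element of
  \<open>mx\<close>.\<close>

lemma mx_add:
  assumes a: "a \<in> mx" and b: "b \<in> mx"
  shows "a + b \<in> mx"
proof (cases "a = 0 \<or> b = 0")
  case True
  then show ?thesis using assms by auto
next
  case False
  have *: "u + v \<in> mx" if "u \<in> mx" "v / u \<in> R" "u \<noteq> 0" for u v
  proof -
    have "(1 + v / u) * u \<in> mx"
      by (intro mx_mult subring_add[OF subring] subring_one[OF subring] that)
    moreover have "(1 + v / u) * u = u + v" using that(3) by (simp add: distrib_right)
    ultimately show ?thesis by simp
  qed
  have "b / a \<in> R \<or> a / b \<in> R"
    using total[of "b / a"] by simp
  then show ?thesis
    using *[of a b] *[of b a] a b False by (auto simp: add.commute)
qed

lemma mx_diff: "a \<in> mx \<Longrightarrow> b \<in> mx \<Longrightarrow> a - b \<in> mx"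
  using mx_add[of a "- b"] mx_uminus[of b] by simp

lemma mx_sum: "(\<And>i. i \<in> I \<Longrightarrow> f i \<in> mx) \<Longrightarrow> sum f I \<in> mx"
  by (induction I rule: infinite_finite_induct) (auto simp: mx_add)

lemma mx_power: "z \<in> mx \<Longrightarrow> 0 < k \<Longrightarrow> z ^ k \<in> mx"
proof (induction k)
  case (Suc k)
  then show ?case
    using mx_mult[of "z ^ k" z] by (simp add: mult.commute subring_power[OF subring] mx_subset)
qed auto

lemma power_mem: "0 < k \<Longrightarrow> z ^ k \<in> R \<Longrightarrow> z \<in> R"
  using mx_power[of "inverse z" k] not_in_iff[of z] not_in_iff[of "z ^ k"]
  by (auto simp: power_inverse)

lemma power_mx: "0 < k \<Longrightarrow> z ^ k \<in> mx \<Longrightarrow> z \<in> mx"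
  using subring_power[OF subring, of "inverse z" k] by (auto simp: mx_def power_inverse)

definition unit :: "'a \<Rightarrow> bool" where
  "unit z \<longleftrightarrow> z \<noteq> 0 \<and> z \<in> R \<and> inverse z \<in> R"

lemma unit_mult: "unit a \<Longrightarrow> unit b \<Longrightarrow> unit (a * b)"
  and unit_inverse: "unit a \<Longrightarrow> unit (inverse a)"
  by (auto simp: unit_def subring_mult[OF subring] inverse_mult_distrib)

lemma unit_power: "unit a \<Longrightarrow> unit (a ^ k)"
  by (induction k) (auto simp: unit_mult, simp add: unit_def subring_one[OF subring])

lemma unit_not_mx: "unit a \<Longrightarrow> a \<notin> mx"
  by (auto simp: unit_def mx_def)

lemma unit_iff: "unit a \<longleftrightarrow> a \<in> R \<and> a \<notin> mx"
  by (auto simp: unit_def mx_def)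

lemma unit_add_mx:
  assumes "unit a" "b \<in> mx"
  shows "unit (a + b)"
proof -
  have "a + b \<notin> mx"
    using mx_diff[of "a + b" b] assms unit_not_mx by auto
  then show ?thesis
    using assms mx_subset by (auto simp: unit_iff subring_add[OF subring])
qed

text \<open>A proper ideal contains no unit, so \<open>P\<close> lies in \<open>mx\<close>; since
  \<open>mx\<close> is a proper ideal too, maximality gives equality.\<close>

lemma maximal_ideal_eq_mx:
  assumes "is_maximal_ideal_of R P"
  shows "P = mx"
proof -
  have P: "is_ideal_of R P" "P \<noteq> R"
    "\<And>J. is_ideal_of R J \<Longrightarrow> P \<subseteq> J \<Longrightarrow> J = P \<or> J = R"
    using assms by (auto simp: is_maximal_ideal_of_def)
  have "P \<subseteq> mx"
  proof
    fix z assume z: "z \<in> P"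
    show "z \<in> mx"
    proof (rule ccontr)
      assume "z \<notin> mx"
      then have nz: "z \<noteq> 0" and inv: "inverse z \<in> R" by (auto simp: mx_def)
      have "r \<in> P" if "r \<in> R" for r
      proof -
        have "r * inverse z \<in> R" using that inv subring_mult[OF subring] by blast
        then have "(r * inverse z) * z \<in> P" using P(1) z by (auto simp: is_ideal_of_def)
        then show ?thesis using nz by (simp add: mult.assoc)
      qed
      then show False using P(1,2) by (auto simp: is_ideal_of_def)
    qed
  qed
  moreover have "is_ideal_of R mx"
    by (auto simp: is_ideal_of_def mx_subset mx_diff mx_mult)
  moreover have "mx \<noteq> R"
    using one_not_mx subring_one[OF subring] by auto
  ultimately show ?thesis using P(3) by blast
qed

end

lemma valuation_subring_of: "is_valuation_ring K R \<Longrightarrow> valuation_subring R"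
  by (auto simp: is_valuation_ring_def valuation_subring_def)

section \<open>Existence of valuation rings missing a given element\<close>

lemma power_one_minus_in_ideal:
  fixes p e :: "'a::field"
  assumes C: "is_subring C" and "p \<in> C" "e \<in> C"
  shows "\<exists>d\<in>C. (1 - p * e) ^ N = 1 - p * d"
proof (induction N)
  case 0
  then show ?case using subring_zero[OF C] by auto
next
  case (Suc N)
  then obtain d where d: "d \<in> C" "(1 - p * e) ^ N = 1 - p * d" by auto
  have "(1 - p * e) ^ Suc N = 1 - p * (e + d - p * e * d)"
    unfolding power_Suc d(2) by (simp add: algebra_simps)
  moreover have "e + d - p * e * d \<in> C"
    using d assms by (auto intro!: subring_closed[OF C])
  ultimately show ?case by blast
qed

text \<open>A subring that is maximal among those missing \<open>z\<close> is a valuation ring: if it contained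
  neither \<open>w\<close> nor \<open>inverse w\<close>, then \<open>1\<close> would be a combination of powers of \<open>w\<close> and one of powers
  of \<open>inverse w\<close>, with coefficients divisible by \<open>inverse z\<close>; each relation can be used to
  shorten the other.\<close>

locale maximal_missing =
  fixes C :: "'a::field set" and z :: 'a
  assumes C: "is_subring C" and inv_z: "inverse z \<in> C" and z: "z \<notin> C"
    and max: "\<And>D. is_subring D \<Longrightarrow> C \<subseteq> D \<Longrightarrow> z \<notin> D \<Longrightarrow> D = C"
begin

definition I :: "'a set" where
  "I = {inverse z * c | c. c \<in> C}"

text \<open>Membership of \<open>1\<close> in the extension of the ideal \<open>I\<close> to
  \<open>C[w]\<close>, with a degree bound \<open>k\<close> that serves as the measure for
  shortening.\<close>

definition one_comb :: "'a \<Rightarrow> nat \<Rightarrow> bool" where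
  "one_comb w k \<longleftrightarrow> (\<exists>a. (\<forall>i. a i \<in> I) \<and> 1 = (\<Sum>i\<le>k. a i * w ^ i))"

lemma z_nz: "z \<noteq> 0"
  using z subring_zero[OF C] by auto

lemma I_add: "a \<in> I \<Longrightarrow> b \<in> I \<Longrightarrow> a + b \<in> I"
  unfolding I_def mem_Collect_eq by (metis distrib_left subring_add[OF C])

lemma I_mult: "a \<in> C \<Longrightarrow> b \<in> I \<Longrightarrow> a * b \<in> I"
  unfolding I_def mem_Collect_eq by (metis mult.left_commute subring_mult[OF C])

lemma I_sub: "a \<in> I \<Longrightarrow> a \<in> C"
  unfolding I_def using inv_z subring_mult[OF C] by auto

lemma I_zero: "0 \<in> I"
  unfolding I_def using subring_zero[OF C] by (auto intro!: exI[of _ 0])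

lemma one_notin_I: "1 \<notin> I"
proof
  assume "1 \<in> I"
  then obtain c where "1 = inverse z * c" "c \<in> C" by (auto simp: I_def)
  then show False using z z_nz by (auto simp: field_simps)
qed

lemma adjoin_has_z:
  assumes "w \<notin> C"
  shows "z \<in> poly_ring C w"
proof (rule ccontr)
  assume "z \<notin> poly_ring C w"
  then have "poly_ring C w = C"
    by (rule max[OF poly_ring_subring[OF C] poly_ring_base[OF C]])
  then show False using poly_ring_gen[OF C, of w] assms by simp
qed

text \<open>Otherwise \<open>z\<close> is a polynomial in \<open>inverse (1 - b)\<close>.
  Multiplication by \<open>(1 - b) ^ N\<close> brings it into \<open>C\<close>; this factor is
  \<open>1\<close> modulo \<open>inverse z\<close>, so the product differs from \<open>z\<close> by
  an element of \<open>C\<close>.\<close>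

lemma one_minus_I_inverse:
  assumes "b \<in> I"
  shows "inverse (1 - b) \<in> C"
proof (rule ccontr)
  assume "inverse (1 - b) \<notin> C"
  from poly_ring_sum[OF adjoin_has_z[OF this]] obtain c N where
    c: "\<And>i. c i \<in> C" and zsum: "z = (\<Sum>i\<le>(N::nat). c i * inverse (1 - b) ^ i)" by metis
  have nz: "1 - b \<noteq> 0" using assms one_notin_I by auto
  have "z * (1 - b) ^ N = (\<Sum>i\<le>N. c i * (1 - b) ^ (N - i))"
    unfolding zsum sum_distrib_right
    by (rule sum.cong) (simp_all add: power_diff[OF nz] power_inverse divide_inverse mult_ac)
  moreover have "(\<Sum>i\<le>N. c i * (1 - b) ^ (N - i)) \<in> C"
    by (intro subring_closed[OF C] c I_sub assms)
  ultimately have 1: "z * (1 - b) ^ N \<in> C" by simp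
  obtain e where e: "e \<in> C" "b = inverse z * e" using assms by (auto simp: I_def)
  obtain d where d: "d \<in> C" "(1 - b) ^ N = 1 - inverse z * d"
    using power_one_minus_in_ideal[OF C inv_z e(1)] e(2) by auto
  have "z * (1 - b) ^ N + d = z"
    unfolding d(2) using z_nz by (simp add: field_simps)
  then show False using subring_add[OF C 1 d(1)] z by simp
qed

lemma one_comb_sumI:
  assumes "finite J" "\<And>j. j \<in> J \<Longrightarrow> a j \<in> I" "\<And>j. j \<in> J \<Longrightarrow> e j \<le> k"
  shows "\<exists>b. (\<forall>i. b i \<in> I) \<and> (\<Sum>j\<in>J. a j * w ^ e j) = (\<Sum>i\<le>k. b i * w ^ i)"
  using assms
proof (induction J rule: finite_induct)
  case empty
  then show ?case using I_zero by (intro exI[of _ "\<lambda>_. 0"]) auto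
next
  case (insert j J)
  then obtain b where b: "\<And>i. b i \<in> I" "(\<Sum>j\<in>J. a j * w ^ e j) = (\<Sum>i\<le>k. b i * w ^ i)"
    by auto
  have "(\<Sum>i\<le>k. (b i + (if i = e j then a j else 0)) * w ^ i)
      = (\<Sum>i\<le>k. b i * w ^ i) + (\<Sum>i\<le>k. if i = e j then a j * w ^ i else 0)"
    by (subst sum.distrib[symmetric]) (rule sum.cong, auto simp: algebra_simps)
  also have "\<dots> = (\<Sum>j\<in>insert j J. a j * w ^ e j)"
    using insert.hyps insert.prems by (simp add: b(2))
  finally show ?case
    using b(1) insert.prems I_zero I_add
    by (intro exI[of _ "\<lambda>i. b i + (if i = e j then a j else 0)"]) auto
qed

text \<open>The relation for \<open>inverse w\<close>, divided by the unit \<open>1 - b 0\<close>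
  and multiplied by \<open>w ^ Suc k\<close>, expresses the top power of \<open>w\<close> by lower
  ones. The bound on \<open>l\<close> keeps the exponents nonnegative.\<close>

lemma one_comb_shorten:
  assumes "one_comb w (Suc k)" "one_comb (inverse w) l" "l \<le> Suc k" "w \<noteq> 0"
  shows "one_comb w k"
proof -
  obtain a where a: "\<And>i. a i \<in> I" "1 = (\<Sum>i\<le>Suc k. a i * w ^ i)"
    using assms(1) by (auto simp: one_comb_def)
  obtain b where b: "\<And>i. b i \<in> I" "1 = (\<Sum>i\<le>l. b i * inverse w ^ i)"
    using assms(2) by (auto simp: one_comb_def)
  define u where "u = inverse (1 - b 0)"
  have u: "u \<in> C" "1 - b 0 \<noteq> 0"
    using one_minus_I_inverse[OF b(1)] b(1)[of 0] one_notin_I by (auto simp: u_def)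
  have "1 = b 0 + (\<Sum>i\<in>{1..l}. b i * inverse w ^ i)"
    by (subst b(2)) (simp add: sum.atMost_shift sum.atLeast1_atMost_eq lessThan_Suc_atMost)
  then have "1 - b 0 = (\<Sum>i\<in>{1..l}. b i * inverse w ^ i)" by (simp add: algebra_simps)
  then have "u * (\<Sum>i\<in>{1..l}. b i * inverse w ^ i) = 1"
    using u(2) by (simp add: u_def)
  then have "w ^ Suc k = (\<Sum>i\<in>{1..l}. b i * inverse w ^ i) * u * w ^ Suc k"
    by (simp add: mult.commute)
  also have "\<dots> = (\<Sum>i\<in>{1..l}. u * b i * w ^ (Suc k - i))"
    unfolding sum_distrib_right
    by (rule sum.cong) (use assms(3,4) in \<open>auto simp: power_diff field_simps simp del: power_Suc\<close>)
  finally have wk: "w ^ Suc k = (\<Sum>i\<in>{1..l}. u * b i * w ^ (Suc k - i))" .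
  have "1 = (\<Sum>i\<le>k. a i * w ^ i) + a (Suc k) * w ^ Suc k"
    using a(2) by simp
  also have "\<dots> = (\<Sum>i\<le>k. a i * w ^ i)
      + (\<Sum>i\<in>{1..l}. (a (Suc k) * u) * b i * w ^ (Suc k - i))"
    unfolding wk sum_distrib_left by (simp add: mult.assoc)
  finally have 1: "1 = (\<Sum>i\<le>k. a i * w ^ i)
      + (\<Sum>i\<in>{1..l}. (a (Suc k) * u) * b i * w ^ (Suc k - i))" .
  have "(a (Suc k) * u) * b i \<in> I" for i
    by (intro I_mult subring_mult[OF C] I_sub a b u)
  then obtain d where d: "\<And>i. d i \<in> I"
    "(\<Sum>i\<in>{1..l}. (a (Suc k) * u) * b i * w ^ (Suc k - i)) = (\<Sum>i\<le>k. d i * w ^ i)"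
    using one_comb_sumI[of "{1..l}" "\<lambda>i. (a (Suc k) * u) * b i" "\<lambda>i. Suc k - i" k w]
    by (metis (no_types, lifting) atLeastAtMost_iff diff_Suc_1 diff_le_mono2 finite_atLeastAtMost)
  have "1 = (\<Sum>i\<le>k. (a i + d i) * w ^ i)"
    by (subst 1) (simp only: d(2) sum.distrib distrib_right)
  then show ?thesis
    unfolding one_comb_def using a(1) d(1) I_add by (intro exI[of _ "\<lambda>i. a i + d i"]) auto
qed

lemma not_both_comb:
  "one_comb w k \<Longrightarrow> one_comb (inverse w) l \<Longrightarrow> w \<noteq> 0 \<Longrightarrow> False"
proof (induction "k + l" arbitrary: k l w rule: less_induct)
  case less
  have 0: "\<not> one_comb v 0" for v
    using one_notin_I by (auto simp: one_comb_def) metis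
  obtain k' l' where kl: "k = Suc k'" "l = Suc l'"
    using less.prems(1,2) 0 by (cases k; cases l) auto
  show False
  proof (cases "l \<le> k")
    case True
    then have "one_comb w k'"
      using one_comb_shorten[of w k' l] less.prems kl by auto
    then show False using less.hyps[of k' l w] less.prems kl by auto
  next
    case False
    then have "one_comb (inverse w) l'"
      using one_comb_shorten[of "inverse w" l' k] less.prems kl by auto
    then show False using less.hyps[of k l' w] less.prems kl by auto
  qed
qed

lemma one_comb_if:
  assumes "w \<notin> C"
  shows "\<exists>k. one_comb w k"
proof -
  from poly_ring_sum[OF adjoin_has_z[OF assms]] obtain c N where
    c: "\<And>i. c i \<in> C" and zsum: "z = (\<Sum>i\<le>(N::nat). c i * w ^ i)" by metis
  have "1 = inverse z * (\<Sum>i\<le>N. c i * w ^ i)"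
    using zsum z_nz by simp
  also have "\<dots> = (\<Sum>i\<le>N. (inverse z * c i) * w ^ i)"
    by (simp add: sum_distrib_left mult.assoc)
  finally show ?thesis
    unfolding one_comb_def I_def using c
    by (intro exI[of _ N] exI[of _ "\<lambda>i. inverse z * c i"]) auto
qed

lemma total: "w \<in> C \<or> inverse w \<in> C"
  using one_comb_if[of w] one_comb_if[of "inverse w"] not_both_comb[of w]
    subring_zero[OF C] by (cases "w = 0") auto

end

text \<open>Zorn's lemma gives a subring that is maximal among those containing \<open>B\<close> and
  missing \<open>z\<close>.\<close>

lemma valuation_ring_missing_exists:
  assumes B: "is_subring B" and "inverse z \<in> B" "z \<notin> B"
  shows "\<exists>R. valuation_subring R \<and> B \<subseteq> R \<and> z \<notin> R"
proof -
  define \<A> where "\<A> = {D. is_subring D \<and> B \<subseteq> D \<and> z \<notin> D}"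
  have "\<exists>M\<in>\<A>. \<forall>X\<in>\<A>. M \<subseteq> X \<longrightarrow> X = M"
  proof (rule subset_Zorn_nonempty)
    show "\<A> \<noteq> {}" using assms by (auto simp: \<A>_def)
    fix \<C> assume ne: "\<C> \<noteq> {}" and ch: "subset.chain \<A> \<C>"
    have sub: "\<And>D. D \<in> \<C> \<Longrightarrow> is_subring D \<and> B \<subseteq> D \<and> z \<notin> D"
      using ch by (auto simp: subset.chain_def \<A>_def)
    have "is_subring (\<Union>\<C>)"
      unfolding is_subring_def
    proof (intro conjI ballI)
      show "1 \<in> \<Union>\<C>" using ne sub subring_one by auto
      fix a b assume "a \<in> \<Union>\<C>" "b \<in> \<Union>\<C>"
      then obtain D E where "D \<in> \<C>" "E \<in> \<C>" "a \<in> D" "b \<in> E" by auto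
      moreover from this have "D \<subseteq> E \<or> E \<subseteq> D"
        using ch by (auto simp: subset.chain_def)
      ultimately obtain G where "G \<in> \<C>" "a \<in> G" "b \<in> G" by auto
      then show "a - b \<in> \<Union>\<C>" "a * b \<in> \<Union>\<C>"
        using sub subring_diff subring_mult by blast+
    qed
    then show "\<Union>\<C> \<in> \<A>" using sub ne by (auto simp: \<A>_def)
  qed
  then obtain M where M: "M \<in> \<A>" "\<And>X. X \<in> \<A> \<Longrightarrow> M \<subseteq> X \<Longrightarrow> X = M" by blast
  interpret maximal_missing M z
    by unfold_locales (use M assms in \<open>auto simp: \<A>_def\<close>)
  have "valuation_subring M"
    by unfold_locales (auto simp: C total)
  then show ?thesis using M(1) by (auto simp: \<A>_def)
qed

section \<open>Linear dependence over a subfield\<close>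

text \<open>Gaussian elimination, one equation at a time: a nonzero coefficient at \<open>k\<close>
  in equation \<open>i\<close> eliminates unknown \<open>k\<close> from the others, and its value
  \<open>- s\<close> is recovered from equation \<open>i\<close>.\<close>

lemma linear_dependence:
  fixes a :: "'i \<Rightarrow> 'j \<Rightarrow> 'a::field"
  assumes L: "is_subfield L" and "finite I" "finite J" "card I < card J"
    and "\<And>i j. i \<in> I \<Longrightarrow> j \<in> J \<Longrightarrow> a i j \<in> L"
  shows "\<exists>c. (\<forall>j\<in>J. c j \<in> L) \<and> (\<exists>j\<in>J. c j \<noteq> 0) \<and> (\<forall>i\<in>I. (\<Sum>j\<in>J. a i j * c j) = 0)"
  using assms(2-5)
proof (induction I arbitrary: J a rule: finite_induct)
  case empty
  then have "J \<noteq> {}" by auto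
  then show ?case
    using subring_one[OF subfield_subring[OF L]] by (intro exI[of _ "\<lambda>_. 1"]) auto
next
  case (insert i I)
  note Lr = subring_closed[OF subfield_subring[OF L]]
  show ?case
  proof (cases "\<forall>j\<in>J. a i j = 0")
    case True
    have "card I < card J" using insert by auto
    with insert.IH[of J a] insert.prems obtain c where
      "\<forall>j\<in>J. c j \<in> L" "\<exists>j\<in>J. c j \<noteq> 0" "\<forall>i\<in>I. (\<Sum>j\<in>J. a i j * c j) = 0" by auto
    then show ?thesis using True by (intro exI[of _ c]) auto
  next
    case False
    then obtain k where k: "k \<in> J" "a i k \<noteq> 0" by auto
    define J' where "J' = J - {k}"
    define b where "b = (\<lambda>i' j. a i' j - a i' k * (a i j / a i k))"
    have J: "J = insert k J'" "k \<notin> J'" "finite J'"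
      using k insert.prems by (auto simp: J'_def)
    have "card I < card J'"
      using insert J by auto
    moreover have "b i' j \<in> L" if "i' \<in> I" "j \<in> J'" for i' j
      unfolding b_def using that insert.prems(3) J k
      by (intro Lr subfield_divide[OF L]) auto
    ultimately obtain c where c: "\<And>j. j \<in> J' \<Longrightarrow> c j \<in> L" "\<exists>j\<in>J'. c j \<noteq> 0"
      "\<And>i'. i' \<in> I \<Longrightarrow> (\<Sum>j\<in>J'. b i' j * c j) = 0"
      using insert.IH[of J' b] J(3) by blast
    define s where "s = (\<Sum>j\<in>J'. (a i j / a i k) * c j)"
    define c' where "c' = (\<lambda>j. if j = k then - s else c j)"
    have sums: "(\<Sum>j\<in>J. a i' j * c' j) = (\<Sum>j\<in>J'. b i' j * c j)" if "i' \<in> insert i I" for i'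
    proof -
      have "(\<Sum>j\<in>J. a i' j * c' j) = - a i' k * s + (\<Sum>j\<in>J'. a i' j * c j)"
        using J by (auto simp: c'_def intro!: sum.cong)
      also have "\<dots> = (\<Sum>j\<in>J'. b i' j * c j)"
        by (simp add: s_def b_def sum_distrib_left left_diff_distrib sum_subtractf mult.assoc
            sum_negf)
      finally show ?thesis .
    qed
    have "(\<Sum>j\<in>J'. b i j * c j) = 0"
      using k by (auto simp: b_def)
    moreover have "s \<in> L"
      unfolding s_def using c(1) insert.prems(3) J k
      by (intro Lr subfield_divide[OF L]) auto
    moreover have "\<exists>j\<in>J. c' j \<noteq> 0" using c(2) J by (auto simp: c'_def)
    moreover have "\<forall>j\<in>J. c' j \<in> L" using c(1) J Lr(5) \<open>s \<in> L\<close> by (auto simp: c'_def)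
    ultimately show ?thesis
      using sums c(3) by (intro exI[of _ c']) auto
  qed
qed

section \<open>Finite subfields of characteristic two\<close>

text \<open>Translation by \<open>1\<close> permutes \<open>K\<close>, so the sum over
  \<open>K\<close> is unchanged when \<open>card K\<close> is added. This later yields
  characteristic two.\<close>

lemma subfield_card_of_nat:
  fixes K :: "'a::field set"
  assumes K: "is_subfield K" and fin: "finite K"
  shows "of_nat (card K) = (0::'a)"
proof -
  note Kr = subring_closed[OF subfield_subring[OF K]]
  have "bij_betw (\<lambda>c. c + 1) K K"
    by (rule bij_betw_byWitness[where f' = "\<lambda>c. c - 1"]) (auto intro!: Kr)
  then have "(\<Sum>c\<in>K. c + 1) = (\<Sum>c\<in>K. c)"
    by (rule sum.reindex_bij_betw)
  then show ?thesis by (simp add: sum.distrib)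
qed

text \<open>Multiplication by a nonzero \<open>a\<close> permutes the nonzero elements of
  \<open>K\<close>; compare the products.\<close>

lemma subfield_power_card:
  assumes K: "is_subfield K" and fin: "finite K" and a: "a \<in> K"
  shows "a ^ card K = (a::'a::field)"
proof (cases "a = 0")
  case True
  have "card K \<noteq> 0" using fin a by auto
  with True show ?thesis by (simp add: power_0_left)
next
  case False
  note Kr = subring_closed[OF subfield_subring[OF K]]
  have "bij_betw (\<lambda>c. a * c) (K - {0}) (K - {0})"
    by (rule bij_betw_byWitness[where f' = "\<lambda>c. c / a"])
      (use False a in \<open>auto intro!: Kr subfield_divide[OF K]\<close>)
  then have "(\<Prod>c\<in>K - {0}. a * c) = (\<Prod>c\<in>K - {0}. c)"
    by (rule prod.reindex_bij_betw)
  then have "a ^ card (K - {0}) * (\<Prod>c\<in>K - {0}. c) = (\<Prod>c\<in>K - {0}. c)"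
    by (simp add: prod.distrib)
  then have "a ^ card (K - {0}) = 1"
    using fin by simp
  moreover have "card K = Suc (card (K - {0}))"
    using fin Kr(2) by (metis card_Suc_Diff1)
  ultimately show ?thesis by simp
qed

lemma sum_power_two_power:
  fixes f :: "'b \<Rightarrow> 'a::field"
  assumes two: "(2::'a) = 0"
  shows "(\<Sum>i\<in>I. f i) ^ (2 ^ j) = (\<Sum>i\<in>I. f i ^ (2 ^ j))"
proof (induction j arbitrary: f)
  case 0
  then show ?case by simp
next
  case (Suc j)
  have sq: "(\<Sum>i\<in>I. f i)\<^sup>2 = (\<Sum>i\<in>I. (f i)\<^sup>2)"
    by (induction I rule: infinite_finite_induct) (auto simp: power2_sum two)
  have "(\<Sum>i\<in>I. f i) ^ (2 ^ Suc j) = ((\<Sum>i\<in>I. f i)\<^sup>2) ^ (2 ^ j)"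
    by (simp add: power_mult)
  also have "\<dots> = (\<Sum>i\<in>I. ((f i)\<^sup>2) ^ (2 ^ j))"
    unfolding sq by (rule Suc.IH)
  finally show ?case by (simp add: power_mult)
qed

lemma add_power_two_power:
  fixes a b :: "'a::field"
  assumes "(2::'a) = 0"
  shows "(a + b) ^ (2 ^ j) = a ^ (2 ^ j) + b ^ (2 ^ j)"
  using sum_power_two_power[OF assms, of "\<lambda>i. if i then a else b" UNIV j]
  by (simp add: UNIV_bool add.commute)

text \<open>A nonzero constant term can be solved for, which gives the inverse as a polynomial in
  \<open>a\<close>; a vanishing one allows division of the relation by \<open>a\<close>.\<close>

lemma inverse_mem_of_relation:
  fixes a :: "'a::field"
  assumes L: "is_subfield L" and D: "is_subring D" "L \<subseteq> D" and a: "a \<in> D" "a \<noteq> 0"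
  shows "(\<And>k. k \<le> N \<Longrightarrow> c k \<in> L) \<Longrightarrow> \<exists>k\<le>N. c k \<noteq> 0 \<Longrightarrow> (\<Sum>k\<le>N. c k * a ^ k) = 0
    \<Longrightarrow> inverse a \<in> D"
proof (induction N arbitrary: c)
  case 0
  then show ?case by auto
next
  case (Suc N)
  have shift: "(\<Sum>k\<le>Suc N. c k * a ^ k) = c 0 + a * (\<Sum>k\<le>N. c (Suc k) * a ^ k)"
    unfolding sum.atMost_Suc_shift by (simp add: sum_distrib_left mult.left_commute)
  show ?case
  proof (cases "c 0 = 0")
    case True
    have "(\<Sum>k\<le>N. c (Suc k) * a ^ k) = 0"
      using Suc.prems(3) shift True a by simp
    moreover have "\<exists>k\<le>N. c (Suc k) \<noteq> 0"
      using Suc.prems(2) True by (metis Suc_le_mono not0_implies_Suc)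
    ultimately show ?thesis
      using Suc.IH[of "\<lambda>k. c (Suc k)"] Suc.prems(1) by auto
  next
    case False
    have "a * (\<Sum>k\<le>N. c (Suc k) * a ^ k) = - c 0"
      using Suc.prems(3) shift by (simp add: eq_neg_iff_add_eq_0 add.commute)
    then have "inverse a = - inverse (c 0) * (\<Sum>k\<le>N. c (Suc k) * a ^ k)"
      using False a by (simp add: field_simps)
    moreover have "- inverse (c 0) * (\<Sum>k\<le>N. c (Suc k) * a ^ k) \<in> D"
      using Suc.prems(1) subfield_inverse[OF L] D a
      by (intro subring_closed[OF D(1)]) auto
    ultimately show ?thesis by simp
  qed
qed

section \<open>The function field as an extension of the rational function field\<close>

locale Y2_field =
  fixes n m :: nat and K :: "'a::field set" and x y :: 'a
  assumes n2: "n \<ge> 2" and m_def: "m = 2 ^ (n - 1)"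
    and K: "is_subfield K" and cardK: "card K = (2 ^ n)\<^sup>2"
    and h_y: "Y2_h n y = x ^ (2 * m + 1)"
    and adjoin: "field_adjoin K {x, y} = UNIV"
begin

lemma two_power_n: "2 ^ n = 2 * m"
  using n2 by (cases n) (auto simp: m_def)

lemma m2: "m \<ge> 2"
proof -
  have "(2::nat) ^ 1 \<le> 2 ^ (n - 1)" using n2 by (intro power_increasing) auto
  then show ?thesis by (simp add: m_def)
qed

lemma finite_K: "finite K"
  using cardK by (intro card_ge_0_finite) simp

lemma two: "(2::'a) = 0"
proof -
  have "of_nat ((2 ^ n)\<^sup>2) = (0::'a)"
    using subfield_card_of_nat[OF K finite_K] cardK by simp
  then show ?thesis by simp
qed

lemma uminus_eq: "- a = (a::'a)"
proof -
  have "a + a = 0" using two by (metis mult_2 mult_zero_left)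
  then show ?thesis by (simp add: minus_unique)
qed

lemma minus_eq_plus: "a - b = a + (b::'a)"
  using uminus_eq[of b] by (metis diff_conv_add_uminus)

lemma add_self: "a + a = (0::'a)"
  using two by (metis mult_2 mult_zero_left)

lemmas K_closed = subring_closed[OF subfield_subring[OF K]]

text \<open>As \<open>Y2_h n w\<close> is monic of degree \<open>m\<close> in \<open>w\<close>, this
  is the ring \<open>B[w]\<close> whenever \<open>Y2_h n w\<close> lies in \<open>B\<close>. It is
  used with \<open>B\<close> equal to \<open>K[x]\<close> or \<open>K(x)\<close> and
  \<open>w\<close> a power of \<open>y\<close>.\<close>

definition lspan :: "'a set \<Rightarrow> 'a \<Rightarrow> 'a set" where
  "lspan B w = {\<Sum>i<m. b i * w ^ i | b. \<forall>i. b i \<in> B}"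

lemma Y2_h_eq: "Y2_h n w = w ^ m + (\<Sum>i<n - 1. w ^ (2 ^ i))"
  using n2 by (cases n) (auto simp: Y2_h_def m_def)

lemma Y2_h_eq': "Y2_h n w = w + (\<Sum>i<n - 1. (w\<^sup>2) ^ (2 ^ i))"
  using n2
  by (cases n) (auto simp: Y2_h_def sum.lessThan_Suc_shift simp del: sum.lessThan_Suc simp flip: power_mult)

context
  fixes B :: "'a set" and w :: 'a
  assumes B: "is_subring B" and h: "Y2_h n w \<in> B"
begin

lemma lspan_add:
  assumes "s \<in> lspan B w" "t \<in> lspan B w"
  shows "s + t \<in> lspan B w"
proof -
  obtain a b where ab: "\<And>i. a i \<in> B" "\<And>i. b i \<in> B"
    "s = (\<Sum>i<m. a i * w ^ i)" "t = (\<Sum>i<m. b i * w ^ i)"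
    using assms by (auto simp: lspan_def)
  have "s + t = (\<Sum>i<m. (a i + b i) * w ^ i)"
    by (simp add: ab sum.distrib distrib_right)
  then show ?thesis
    unfolding lspan_def using ab subring_add[OF B]
    by (intro CollectI exI[of _ "\<lambda>i. a i + b i"]) auto
qed

lemma lspan_scale:
  assumes "c \<in> B" "t \<in> lspan B w"
  shows "c * t \<in> lspan B w"
proof -
  obtain b where b: "\<And>i. b i \<in> B" "t = (\<Sum>i<m. b i * w ^ i)"
    using assms by (auto simp: lspan_def)
  have "c * t = (\<Sum>i<m. (c * b i) * w ^ i)"
    by (simp add: b sum_distrib_left mult.assoc)
  then show ?thesis
    unfolding lspan_def using b assms(1) subring_mult[OF B]
    by (intro CollectI exI[of _ "\<lambda>i. c * b i"]) auto
qed

lemma lspan_zero: "0 \<in> lspan B w"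
  unfolding lspan_def using subring_zero[OF B] by (intro CollectI exI[of _ "\<lambda>_. 0"]) auto

lemma lspan_sum: "(\<And>i. i \<in> I \<Longrightarrow> f i \<in> lspan B w) \<Longrightarrow> sum f I \<in> lspan B w"
  by (induction I rule: infinite_finite_induct) (auto simp: lspan_zero lspan_add)

lemma lspan_power_less:
  assumes "j < m"
  shows "w ^ j \<in> lspan B w"
proof -
  have "(\<Sum>i<m. (if i = j then 1 else 0) * w ^ i) = (\<Sum>i<m. if i = j then w ^ i else 0)"
    by (rule sum.cong) auto
  also have "\<dots> = w ^ j" using assms by simp
  finally show ?thesis
    unfolding lspan_def using B subring_zero subring_one
    by (intro CollectI exI[of _ "\<lambda>i. if i = j then 1 else 0"]) auto
qed

lemma lspan_base: "B \<subseteq> lspan B w"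
proof
  fix c assume "c \<in> B"
  then have "c * w ^ 0 \<in> lspan B w"
    using m2 by (intro lspan_scale lspan_power_less) auto
  then show "c \<in> lspan B w" by simp
qed

lemma lspan_gen: "w \<in> lspan B w"
  using lspan_power_less[of 1] m2 by simp

lemma lspan_power_m: "w ^ m \<in> lspan B w"
proof -
  have "w ^ m = Y2_h n w + (\<Sum>i<n - 1. w ^ (2 ^ i))"
    by (simp add: Y2_h_eq add.assoc add_self)
  moreover have "(2::nat) ^ i < m" if "i < n - 1" for i
    unfolding m_def using that by (intro power_strict_increasing) auto
  ultimately show ?thesis
    using h lspan_base by (auto intro!: lspan_add lspan_sum lspan_power_less)
qed

lemma lspan_mult_gen:
  assumes "t \<in> lspan B w"
  shows "w * t \<in> lspan B w"
proof -
  obtain b where b: "\<And>i. b i \<in> B" "t = (\<Sum>i<m. b i * w ^ i)"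
    using assms by (auto simp: lspan_def)
  have "w * t = (\<Sum>i<m. b i * w ^ Suc i)"
    by (simp add: b sum_distrib_left mult.left_commute)
  moreover have "w ^ Suc i \<in> lspan B w" if "i < m" for i
    using that lspan_power_less[of "Suc i"] lspan_power_m by (cases "Suc i = m") auto
  ultimately show ?thesis using b(1) by (auto simp del: power_Suc intro!: lspan_sum lspan_scale)
qed

lemma lspan_mult_power: "t \<in> lspan B w \<Longrightarrow> w ^ k * t \<in> lspan B w"
  by (induction k) (auto simp: mult.assoc lspan_mult_gen)

lemma lspan_subring: "is_subring (lspan B w)"
  unfolding is_subring_def
proof (intro conjI ballI)
  show "1 \<in> lspan B w" using lspan_base subring_one[OF B] by auto
  fix s t assume st: "s \<in> lspan B w" "t \<in> lspan B w"
  then show "s - t \<in> lspan B w" by (simp add: minus_eq_plus lspan_add)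
  obtain a where a: "\<And>i. a i \<in> B" "s = (\<Sum>i<m. a i * w ^ i)"
    using st by (auto simp: lspan_def)
  have "s * t = (\<Sum>i<m. a i * (w ^ i * t))"
    by (simp add: a sum_distrib_right mult.assoc)
  then show "s * t \<in> lspan B w"
    using a(1) st by (auto intro!: lspan_sum lspan_scale lspan_mult_power)
qed

lemma lspan_least:
  assumes D: "is_subring D" "B \<subseteq> D" "w \<in> D"
  shows "lspan B w \<subseteq> D"
  using D by (auto simp: lspan_def intro!: subring_closed[OF D(1)])

end

lemma Y2_h_power: "Y2_h n (w ^ 2 ^ j) = Y2_h n (w::'a) ^ 2 ^ j"
  using sum_power_two_power[OF two, of "\<lambda>i. w ^ 2 ^ i" "{..<n}" j]
  by (simp add: Y2_h_def mult.commute flip: power_mult)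

text \<open>Since \<open>w\<close> occurs in \<open>Y2_h n w\<close> to the first power only, it is a polynomial in \<open>w\<^sup>2\<close> over \<open>B\<close>.\<close>

lemma lspan_frobenius:
  assumes B: "is_subring B" and h: "Y2_h n w \<in> B"
  shows "lspan B w \<subseteq> lspan B (w ^ 2 ^ j)"
proof (induction j)
  case 0
  then show ?case by simp
next
  case (Suc j)
  define v where "v = w ^ 2 ^ j"
  have hv: "Y2_h n v \<in> B"
    unfolding v_def Y2_h_power using h by (rule subring_power[OF B])
  have hv2: "Y2_h n (v\<^sup>2) \<in> B"
    using Y2_h_power[of v 1] subring_power[OF B hv, of 2] by simp
  note sp = lspan_subring[OF B hv2] lspan_base[OF B hv2] lspan_gen[OF B hv2]
  have "v = Y2_h n v + (\<Sum>i<n - 1. (v\<^sup>2) ^ (2 ^ i))"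
    by (simp add: Y2_h_eq' add.assoc add_self)
  also have "\<dots> \<in> lspan B (v\<^sup>2)"
    using hv sp by (auto intro!: subring_closed[OF sp(1)])
  finally have "lspan B v \<subseteq> lspan B (v\<^sup>2)"
    by (intro lspan_least[OF B hv] sp)
  moreover have "v\<^sup>2 = w ^ 2 ^ Suc j"
    by (simp add: v_def mult.commute flip: power_mult)
  ultimately show ?case using Suc by (simp add: v_def)
qed

text \<open>At a pole of \<open>w\<close> the top power dominates: dividing by \<open>w ^ m\<close>
  leaves \<open>1\<close> plus positive powers of \<open>inverse w\<close>.\<close>

lemma h_eq_power_times_unit:
  assumes "valuation_subring T" and w: "w \<notin> T"
  obtains u where "valuation_subring.unit T u" "Y2_h n w = w ^ m * u"
proof -
  interpret T: valuation_subring T by fact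
  define u where "u = 1 + (\<Sum>i<n - 1. inverse w ^ (m - 2 ^ i))"
  have nz: "w \<noteq> 0" and inv: "inverse w \<in> T.mx" using w T.not_in_iff by auto
  have lt: "(2::nat) ^ i < m" if "i < n - 1" for i
    unfolding m_def using that by (intro power_strict_increasing) auto
  have "w ^ m * inverse w ^ (m - 2 ^ i) = w ^ 2 ^ i" if "i < n - 1" for i
    using lt[OF that] nz by (simp add: power_inverse power_diff field_simps)
  then have h: "Y2_h n w = w ^ m * u"
    unfolding u_def Y2_h_eq by (simp add: distrib_left sum_distrib_left)
  have "T.unit u"
    unfolding u_def using lt inv
    by (intro T.unit_add_mx T.mx_sum T.mx_power) (auto simp: T.unit_def subring_one[OF T.subring])
  then show ?thesis using h by (rule that)
qed

section \<open>The rational function field and coordinates over it\<close>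

definition Kx :: "'a set" where
  "Kx = poly_ring K x"

definition L :: "'a set" where
  "L = {u / v | u v. u \<in> Kx \<and> v \<in> Kx \<and> v \<noteq> 0}"

lemma Kx_subring: "is_subring Kx"
  unfolding Kx_def by (rule poly_ring_subring[OF subfield_subring[OF K]])

lemmas Kx_closed = subring_closed[OF Kx_subring]

lemma K_Kx: "K \<subseteq> Kx"
  unfolding Kx_def by (rule poly_ring_base[OF subfield_subring[OF K]])

lemma x_Kx: "x \<in> Kx"
  unfolding Kx_def by (rule poly_ring_gen[OF subfield_subring[OF K]])

lemma L_subfield: "is_subfield L"
  unfolding is_subfield_def is_subring_def
proof (intro conjI ballI)
  show "1 \<in> L"
    unfolding L_def using Kx_closed(1) by (intro CollectI exI[of _ 1]) auto
  fix a b assume "a \<in> L" "b \<in> L"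
  then obtain u v u' v' where uv: "a = u / v" "b = u' / v'" "u \<in> Kx" "v \<in> Kx" "v \<noteq> 0"
    "u' \<in> Kx" "v' \<in> Kx" "v' \<noteq> 0" by (auto simp: L_def)
  have "a - b = (u * v' - u' * v) / (v * v')" "a * b = (u * u') / (v * v')"
    using uv by (auto simp: field_simps)
  moreover have "u * v' - u' * v \<in> Kx" "v * v' \<in> Kx" "u * u' \<in> Kx" "v * v' \<noteq> 0"
    using uv by (auto intro!: Kx_closed)
  ultimately show "a - b \<in> L" "a * b \<in> L" unfolding L_def by blast+
next
  fix a assume "a \<in> L"
  then obtain u v where uv: "a = u / v" "u \<in> Kx" "v \<in> Kx" "v \<noteq> 0" by (auto simp: L_def)
  show "inverse a \<in> L"
  proof (cases "u = 0")
    case True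
    have "0 / 1 \<in> L"
      unfolding L_def using Kx_closed(1,2) by (intro CollectI exI[of _ 0] exI[of _ 1]) auto
    then show ?thesis using True uv by simp
  next
    case False
    then have "inverse a = v / u" using uv(1) by simp
    then show ?thesis using False uv unfolding L_def by blast
  qed
qed

lemmas L_subring = subfield_subring[OF L_subfield]
lemmas L_closed = subring_closed[OF L_subring]

lemma Kx_L: "Kx \<subseteq> L"
proof
  fix u assume "u \<in> Kx"
  then show "u \<in> L"
    unfolding L_def using Kx_closed(1) by (intro CollectI exI[of _ u] exI[of _ 1]) auto
qed

lemma h_y_Kx: "Y2_h n y \<in> Kx"
  unfolding h_y by (intro Kx_closed x_Kx)

lemma h_y_L: "Y2_h n y \<in> L"
  using h_y_Kx Kx_L by auto

text \<open>The \<open>m + 1\<close> powers \<open>a ^ 0, ..., a ^ m\<close> lie in a span of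
  \<open>m\<close> elements over \<open>L\<close>, so they satisfy a linear relation over
  \<open>L\<close>.\<close>

lemma lspan_L_inverse:
  assumes a: "a \<in> lspan L y"
  shows "inverse a \<in> lspan L y"
proof (cases "a = 0")
  case False
  note sp = lspan_subring[OF L_subring h_y_L]
  have "\<forall>k. \<exists>g. (\<forall>i. g i \<in> L) \<and> a ^ k = (\<Sum>i<m. g i * y ^ i)"
    using subring_power[OF sp a] by (auto simp: lspan_def)
  then obtain g where g: "\<And>k i. g k i \<in> L" "\<And>k. a ^ k = (\<Sum>i<m. g k i * y ^ i)"
    by metis
  obtain c where c: "\<forall>k\<in>{..m}. c k \<in> L" "\<exists>k\<in>{..m}. c k \<noteq> 0"
    "\<forall>i\<in>{..<m}. (\<Sum>k\<le>m. g k i * c k) = 0"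
    using linear_dependence[OF L_subfield, of "{..<m}" "{..m}" "\<lambda>i k. g k i"] g(1) by auto
  have "(\<Sum>k\<le>m. c k * a ^ k) = (\<Sum>k\<le>m. \<Sum>i<m. g k i * c k * y ^ i)"
    by (simp add: g(2) sum_distrib_left mult_ac)
  also have "\<dots> = (\<Sum>i<m. (\<Sum>k\<le>m. g k i * c k) * y ^ i)"
    by (subst sum.swap) (simp add: sum_distrib_right)
  also have "\<dots> = 0" using c(3) by simp
  finally show ?thesis
    using inverse_mem_of_relation[OF L_subfield sp lspan_base[OF L_subring h_y_L] a False, of m c]
      c by auto
qed (use a in auto)

lemma lspan_L_eq_UNIV: "lspan L y = UNIV"
proof -
  have "is_subfield (lspan L y)"
    unfolding is_subfield_def using lspan_subring[OF L_subring h_y_L] lspan_L_inverse by blast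
  moreover have "K \<subseteq> lspan L y" "x \<in> lspan L y"
    using lspan_base[OF L_subring h_y_L] Kx_L K_Kx x_Kx by auto
  moreover have "y \<in> lspan L y" by (rule lspan_gen[OF L_subring h_y_L])
  ultimately have "field_adjoin K {x, y} \<subseteq> lspan L y"
    unfolding field_adjoin_def by blast
  then show ?thesis using adjoin by auto
qed

text \<open>An arbitrary choice: uniqueness is established in \<open>powers_independent\<close>,
  with the help of a place at infinity.\<close>

definition coord :: "'a \<Rightarrow> nat \<Rightarrow> 'a" where
  "coord z = (SOME c. (\<forall>i. c i \<in> L) \<and> z = (\<Sum>i<m. c i * y ^ i))"

lemma coord_conj: "(\<forall>i. coord z i \<in> L) \<and> z = (\<Sum>i<m. coord z i * y ^ i)"
proof -
  have "z \<in> lspan L y" by (simp add: lspan_L_eq_UNIV)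
  then have "\<exists>c. (\<forall>i. c i \<in> L) \<and> z = (\<Sum>i<m. c i * y ^ i)"
    by (auto simp: lspan_def)
  then show ?thesis unfolding coord_def by (rule someI_ex)
qed

lemma coord_L: "coord z i \<in> L"
  by (rule conjunct1[OF coord_conj, THEN spec])

lemma coord_sum: "z = (\<Sum>i<m. coord z i * y ^ i)"
  by (rule conjunct2[OF coord_conj])

lemma ex_coord_nonzero:
  assumes "z \<noteq> 0"
  shows "\<exists>i<m. coord z i \<noteq> 0"
proof (rule ccontr)
  assume "\<not> ?thesis"
  then have "(\<Sum>i<m. coord z i * y ^ i) = 0" by simp
  then show False using assms coord_sum[of z] by argo
qed

text \<open>A relation, since a fraction has many representations. That \<open>k\<close> is
  determined by \<open>z\<close> follows from \<open>has_deg_wt\<close> and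
  \<open>wt_unique\<close>.\<close>

definition has_deg :: "'a \<Rightarrow> int \<Rightarrow> bool" where
  "has_deg z k \<longleftrightarrow> (\<exists>p r. (\<forall>i. coeff p i \<in> K) \<and> (\<forall>i. coeff r i \<in> K) \<and> p \<noteq> 0 \<and> r \<noteq> 0 \<and>
     z = poly p x / poly r x \<and> k = int (degree p) - int (degree r))"

lemma Kx_has_deg:
  assumes "u \<in> Kx" "u \<noteq> 0"
  obtains p where "\<And>i. coeff p i \<in> K" "p \<noteq> 0" "u = poly p x" "has_deg u (int (degree p))"
proof -
  obtain p where p: "u = poly p x" "\<And>i. coeff p i \<in> K"
    using assms by (auto simp: Kx_def poly_ring_def)
  have nz: "p \<noteq> 0" using p assms(2) by auto
  have one: "coeff 1 i \<in> K" for i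
    by (simp add: coeff_1 K_closed(1,2))
  have "has_deg u (int (degree p))"
    unfolding has_deg_def using p nz one
    by (intro exI[of _ p] exI[of _ 1]) simp
  then show ?thesis using that p nz by blast
qed

lemma L_has_deg:
  assumes "z \<in> L" "z \<noteq> 0"
  shows "\<exists>k. has_deg z k"
proof -
  obtain u v where uv: "z = u / v" "u \<in> Kx" "v \<in> Kx" "v \<noteq> 0" using assms by (auto simp: L_def)
  have "u \<noteq> 0" using uv(1) assms(2) by auto
  then obtain p where p: "\<And>i. coeff p i \<in> K" "p \<noteq> 0" "u = poly p x"
    using Kx_has_deg[OF uv(2)] by blast
  obtain r where r: "\<And>i. coeff r i \<in> K" "r \<noteq> 0" "v = poly r x"
    using Kx_has_deg[OF uv(3,4)] by blast
  show ?thesis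
    unfolding has_deg_def using p r uv(1)
    by (intro exI[of _ "int (degree p) - int (degree r)"] exI[of _ p] exI[of _ r]) auto
qed

text \<open>The pole order at infinity of \<open>c i * y ^ i\<close>, where \<open>c i\<close> has degree \<open>k\<close> in \<open>x\<close>, is
  \<open>k * m + i * (2 * m + 1)\<close>, which is congruent to \<open>i\<close> modulo \<open>m\<close>; so one term dominates.\<close>

definition dominant :: "(nat \<Rightarrow> 'a) \<Rightarrow> nat \<Rightarrow> int \<Rightarrow> bool" where
  "dominant c i k \<longleftrightarrow> i < m \<and> has_deg (c i) k \<and>
    (\<forall>j<m. j \<noteq> i \<longrightarrow> c j = 0 \<or> (\<exists>l. has_deg (c j) l \<and>
        l * int m + int j * (2 * int m + 1) < k * int m + int i * (2 * int m + 1)))"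

lemma ex_dominant:
  assumes c: "\<And>i. c i \<in> L" and ex: "\<exists>i<m. c i \<noteq> 0"
  shows "\<exists>i k. dominant c i k"
proof -
  define J where "J = {i. i < m \<and> c i \<noteq> 0}"
  have "\<forall>i\<in>J. \<exists>k. has_deg (c i) k"
    using L_has_deg c by (auto simp: J_def)
  then obtain d where d: "\<And>i. i \<in> J \<Longrightarrow> has_deg (c i) (d i)"
    unfolding bchoice_iff by blast
  define W where "W = (\<lambda>i. d i * int m + int i * (2 * int m + 1))"
  have "finite J" "J \<noteq> {}" using ex by (auto simp: J_def)
  then obtain i where "i \<in> J" "W i = Max (W ` J)"
    using Max_in[of "W ` J"] by fastforce
  with \<open>finite J\<close> have i: "i \<in> J" "\<And>j. j \<in> J \<Longrightarrow> W j \<le> W i"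
    by auto
  have "W j < W i" if "j \<in> J" "j \<noteq> i" for j
  proof -
    have mod: "W k mod int m = int k" if "k \<in> J" for k
    proof -
      have "W k = int k + (d k + 2 * int k) * int m" by (simp add: W_def algebra_simps)
      then show ?thesis using that by (simp add: J_def)
    qed
    show ?thesis using i that mod[of i] mod[of j] by (metis of_nat_eq_iff order_le_less)
  qed
  then show ?thesis
    using i(1) d unfolding W_def J_def dominant_def by (intro exI[of _ i] exI[of _ "d i"]) auto
qed

end

section \<open>The place at infinity\<close>

locale Y2_infinity = Y2_field n m K x y + valuation_subring R
  for n m :: nat and K :: "'a::field set" and x y :: 'a and R :: "'a set" +
  assumes K_sub: "K \<subseteq> R" and x_pole: "x \<notin> R"
begin

lemma x_nz: "x \<noteq> 0" and inv_x: "inverse x \<in> mx"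
  using x_pole not_in_iff by auto

lemma K_unit: "c \<in> K \<Longrightarrow> c \<noteq> 0 \<Longrightarrow> unit c"
  using K_sub subfield_inverse[OF K] by (auto simp: unit_def)

lemma y_pole: "y \<notin> R"
proof
  assume "y \<in> R"
  then have "Y2_h n y \<in> R" unfolding Y2_h_def by (intro subring_closed[OF subring])
  then have "x ^ (2 * m + 1) \<in> R" by (simp add: h_y)
  then show False using power_mem[of "2 * m + 1" x] x_pole by auto
qed

lemma y_nz: "y \<noteq> 0" and inv_y: "inverse y \<in> mx"
  using y_pole not_in_iff by auto

lemma y_power_unit: "unit (y ^ m / x ^ (2 * m + 1))"
proof -
  obtain u where "unit u" "x ^ (2 * m + 1) = y ^ m * u"
    by (rule h_eq_power_times_unit[OF valuation_subring_axioms y_pole, unfolded h_y])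
  then show ?thesis using unit_inverse[of u] y_nz by (simp add: inverse_eq_divide)
qed

text \<open>The \<open>m\<close>-th power of every nonzero element is a unit times a power of \<open>x\<close>, because \<open>x\<close> has
  pole order \<open>m\<close>. So \<open>wt z k\<close> says that \<open>z\<close> has pole order \<open>k\<close>.\<close>

definition wt :: "'a \<Rightarrow> int \<Rightarrow> bool" where
  "wt z k \<longleftrightarrow> z \<noteq> 0 \<and> unit (z ^ m / x powi k)"

lemma wt_nz: "wt z k \<Longrightarrow> z \<noteq> 0"
  by (simp add: wt_def)

lemma wt_mult: "wt z k \<Longrightarrow> wt w l \<Longrightarrow> wt (z * w) (k + l)"
  using unit_mult[of "z ^ m / x powi k" "w ^ m / x powi l"]
  by (simp add: wt_def power_int_add[OF disjI1[OF x_nz]] power_mult_distrib)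

lemma wt_inverse: "wt z k \<Longrightarrow> wt (inverse z) (- k)"
proof -
  assume z: "wt z k"
  have "inverse z ^ m / x powi (- k) = inverse (z ^ m / x powi k)"
    by (simp add: power_int_minus power_inverse divide_inverse)
  then show ?thesis
    using z unit_inverse[of "z ^ m / x powi k"] unfolding wt_def by simp
qed

lemma wt_unit: "unit u \<Longrightarrow> wt u 0"
  by (auto simp: wt_def unit_power) (simp add: unit_def)

lemma wt_power: "wt z k \<Longrightarrow> wt (z ^ j) (int j * k)"
proof (induction j)
  case 0
  then show ?case using wt_unit[of 1] by (simp add: unit_def subring_one[OF subring])
next
  case (Suc j)
  then show ?case using wt_mult[of z k "z ^ j" "int j * k"] by (simp add: algebra_simps)
qed

lemma wt_x: "wt x (int m)"
  using x_nz by (simp add: wt_def unit_def subring_one[OF subring])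

lemma wt_y: "wt y (2 * int m + 1)"
proof -
  have "2 * int m + 1 = int (2 * m + 1)" by simp
  then have "x powi (2 * int m + 1) = x ^ (2 * m + 1)"
    by (simp only: power_int_of_nat)
  then show ?thesis using y_power_unit y_nz unfolding wt_def by metis
qed

lemma wt_x_powi: "wt (x powi k) (k * int m)"
proof (cases "k \<ge> 0")
  case True
  then show ?thesis using wt_power[OF wt_x, of "nat k"] by (simp add: power_int_def)
next
  case False
  then show ?thesis
    using wt_inverse[OF wt_power[OF wt_x, of "nat (- k)"]]
    by (simp add: power_int_def power_inverse)
qed

lemma wt_neg: "wt z k \<Longrightarrow> k < 0 \<Longrightarrow> z \<in> mx"
proof -
  assume z: "wt z k" and k: "k < 0"
  have "x powi k = inverse x ^ nat (- k)" using k by (simp add: power_int_def)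
  then have "x powi k \<in> mx" using k mx_power[OF inv_x] by simp
  then have "(z ^ m / x powi k) * x powi k \<in> mx"
    using z by (intro mx_mult) (auto simp: wt_def unit_def)
  then have "z ^ m \<in> mx" using x_nz by simp
  then show ?thesis using power_mx[of m z] m2 by simp
qed

lemma wt_zero: "wt z 0 \<Longrightarrow> unit z"
proof -
  assume z: "wt z 0"
  then have "z ^ m \<in> R" "inverse z ^ m \<in> R" "z \<noteq> 0"
    by (auto simp: wt_def unit_def power_inverse)
  then show ?thesis
    using power_mem[of m z] power_mem[of m "inverse z"] m2 by (auto simp: unit_def)
qed

lemma wt_mem_iff: "wt z k \<Longrightarrow> z \<in> R \<longleftrightarrow> k \<le> 0"
  using wt_neg[of z k] wt_zero[of z] mx_subset[of z] wt_neg[OF wt_inverse, of z k] not_in_iff[of z]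
    wt_nz[of z k]
  by (cases k "0::int" rule: linorder_cases) (auto simp: unit_iff)

lemma wt_mx_iff: "wt z k \<Longrightarrow> z \<in> mx \<longleftrightarrow> k < 0"
  using wt_neg[of z k] wt_zero[of z] mx_subset[of z] wt_mem_iff[of z k]
  by (cases k "0::int" rule: linorder_cases) (auto simp: unit_iff)

lemma wt_unique: "wt z k \<Longrightarrow> wt z l \<Longrightarrow> k = l"
proof -
  assume z: "wt z k" "wt z l"
  have "wt 1 (k - l)" using wt_mult[OF z(1) wt_inverse[OF z(2)]] wt_nz[OF z(1)] by simp
  then show ?thesis
    using wt_mem_iff[of 1 "k - l"] wt_mx_iff[of 1 "k - l"] one_not_mx subring_one[OF subring]
    by simp
qed

lemma wt_add_less:
  assumes "wt z k" "w = 0 \<or> (\<exists>l<k. wt w l)"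
  shows "wt (z + w) k"
proof -
  have nz: "z \<noteq> 0" using assms wt_nz by auto
  have "w / z \<in> mx"
  proof (cases "w = 0")
    case False
    then obtain l where l: "l < k" "wt w l" using assms by auto
    have "wt (w * inverse z) (l + - k)" by (rule wt_mult[OF l(2) wt_inverse[OF assms(1)]])
    then show ?thesis using l wt_neg by (simp add: divide_inverse)
  qed auto
  then have "wt (1 + w / z) 0"
    by (intro wt_unit unit_add_mx) (auto simp: unit_def subring_one[OF subring])
  from wt_mult[OF assms(1) this] show ?thesis using nz by (simp add: distrib_left)
qed

lemma wt_add_sum_less:
  assumes "wt z k" "finite J" "\<And>j. j \<in> J \<Longrightarrow> f j = 0 \<or> (\<exists>l<k. wt (f j) l)"
  shows "wt (z + sum f J) k"
  using assms(2,3)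
proof (induction J rule: finite_induct)
  case empty
  then show ?case using assms(1) by simp
next
  case (insert j J)
  have "wt (z + sum f J) k" by (rule insert.IH) (rule insert.prems, simp)
  moreover have "f j = 0 \<or> (\<exists>l<k. wt (f j) l)" by (rule insert.prems) simp
  ultimately have "wt ((z + sum f J) + f j) k" by (rule wt_add_less)
  then show ?case using insert.hyps by (simp add: add_ac)
qed

section \<open>Leading terms and pole orders at infinity\<close>

lemma poly_leading_term:
  assumes "\<And>i. coeff p i \<in> K" "p \<noteq> 0"
  shows "\<exists>e\<in>mx. poly p x = x ^ degree p * (lead_coeff p + e)"
  using assms
proof (induction p)
  case 0
  then show ?case by simp
next
  case (pCons a p)
  have a: "a \<in> K" using pCons.prems(1)[of 0] by simp
  have p: "coeff p i \<in> K" for i using pCons.prems(1)[of "Suc i"] by simp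
  show ?case
  proof (cases "p = 0")
    case True
    then show ?thesis by (intro bexI[of _ 0]) auto
  next
    case False
    then obtain e where e: "e \<in> mx" "poly p x = x ^ degree p * (lead_coeff p + e)"
      using pCons.IH p by auto
    have "a * inverse x ^ Suc (degree p) \<in> mx"
      using a K_sub by (intro mx_mult mx_power inv_x) auto
    moreover have "poly (pCons a p) x
        = x ^ Suc (degree p) * (lead_coeff p + (e + a * inverse x ^ Suc (degree p)))"
      using x_nz by (simp add: e(2) distrib_left power_inverse field_simps)
    ultimately show ?thesis
      using e(1) False by (intro bexI[of _ "e + a * inverse x ^ Suc (degree p)"] mx_add) auto
  qed
qed

lemma has_deg_leading_term:
  assumes "has_deg z k"
  shows "\<exists>c\<in>K - {0}. \<exists>e\<in>mx. z = x powi k * (c + e)"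
proof -
  obtain p r where pr: "\<And>i. coeff p i \<in> K" "\<And>i. coeff r i \<in> K" "p \<noteq> 0" "r \<noteq> 0"
     "z = poly p x / poly r x" "k = int (degree p) - int (degree r)"
    using assms by (auto simp: has_deg_def)
  obtain e where e: "e \<in> mx" "poly p x = x ^ degree p * (lead_coeff p + e)"
    using poly_leading_term pr by blast
  obtain d where d: "d \<in> mx" "poly r x = x ^ degree r * (lead_coeff r + d)"
    using poly_leading_term pr by blast
  define a b where "a = lead_coeff p" and "b = lead_coeff r"
  have ab: "a \<in> K" "b \<in> K" "a \<noteq> 0" "b \<noteq> 0" using pr by (auto simp: a_def b_def)
  have u: "unit (b + d)" using ab d K_unit by (intro unit_add_mx) auto
  have c: "a / b \<in> K - {0}" using ab subfield_divide[OF K] by auto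
  have k: "x powi k = x ^ degree p / x ^ degree r"
    using x_nz by (simp add: pr(6) power_int_diff)
  have nz: "b + d \<noteq> 0" using u by (simp add: unit_def)
  have "z = x powi k * ((a + e) / (b + d))"
    by (simp add: pr(5) e(2) d(2) a_def b_def k)
  also have "a + e = a / b * (b + d) + (e - a / b * d)"
    using ab by (simp add: distrib_left)
  also have "\<dots> / (b + d) = a / b + (e - a / b * d) / (b + d)"
    unfolding add_divide_distrib[of _ _ "b + d"] nonzero_mult_div_cancel_right[OF nz] ..
  also have "(e - a / b * d) / (b + d) = inverse (b + d) * (e - a / b * d)"
    by (rule divide_inverse_commute)
  finally have "z = x powi k * (a / b + inverse (b + d) * (e - a / b * d))" .
  moreover have "inverse (b + d) * (e - a / b * d) \<in> mx"
    using u c e(1) d(1) K_sub by (intro mx_mult mx_diff) (auto simp: unit_def)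
  ultimately show ?thesis using c by blast
qed

lemma has_deg_wt:
  assumes "has_deg z k"
  shows "wt z (k * int m)"
proof -
  obtain c e where "c \<in> K" "c \<noteq> 0" "e \<in> mx" "z = x powi k * (c + e)"
    using has_deg_leading_term[OF assms] by auto
  then show ?thesis
    using wt_mult[OF wt_x_powi wt_unit[OF unit_add_mx[OF K_unit]]] by simp
qed

lemma wt_term: "has_deg z k \<Longrightarrow> wt (z * y ^ i) (k * int m + int i * (2 * int m + 1))"
  using wt_mult[OF has_deg_wt wt_power[OF wt_y]] .

lemma dominant_wt:
  assumes "dominant c i k"
  shows "wt (\<Sum>i<m. c i * y ^ i) (k * int m + int i * (2 * int m + 1))"
proof -
  have "wt (c i * y ^ i + (\<Sum>j\<in>{..<m} - {i}. c j * y ^ j)) (k * int m + int i * (2 * int m + 1))"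
  proof (rule wt_add_sum_less)
    show "wt (c i * y ^ i) (k * int m + int i * (2 * int m + 1))"
      using assms by (intro wt_term) (simp add: dominant_def)
    fix j assume "j \<in> {..<m} - {i}"
    then consider "c j = 0" | l where "has_deg (c j) l"
      "l * int m + int j * (2 * int m + 1) < k * int m + int i * (2 * int m + 1)"
      using assms by (auto simp: dominant_def)
    then show "c j * y ^ j = 0 \<or> (\<exists>l<k * int m + int i * (2 * int m + 1). wt (c j * y ^ j) l)"
      by cases (auto dest: wt_term)
  qed simp
  then show ?thesis using assms by (simp add: sum.remove[of "{..<m}" i] dominant_def)
qed

text \<open>One term strictly dominates, so no cancellation occurs at the top: the pole order of the
  sum is the largest among its terms and bounds each of them.\<close>

lemma coordinates_bounded:
  assumes c: "\<And>i. c i \<in> L"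
    and z: "(\<Sum>i<m. c i * y ^ i) = 0 \<or> (\<exists>l\<le>b. wt (\<Sum>i<m. c i * y ^ i) l)"
    and j: "j < m"
  shows "c j = 0 \<or> (\<exists>l. has_deg (c j) l \<and> l * int m + int j * (2 * int m + 1) \<le> b)"
proof (cases "\<exists>i<m. c i \<noteq> 0")
  case True
  obtain i k where ik: "dominant c i k" using ex_dominant[OF c True] by auto
  have w: "wt (\<Sum>i<m. c i * y ^ i) (k * int m + int i * (2 * int m + 1))"
    by (rule dominant_wt[OF ik])
  then have b: "k * int m + int i * (2 * int m + 1) \<le> b"
    using z wt_unique[OF w] wt_nz[OF w] by blast
  show ?thesis
  proof (cases "j = i")
    case True
    then show ?thesis using ik b by (auto simp: dominant_def)
  next
    case False
    then consider "c j = 0" | l where "has_deg (c j) l"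
      "l * int m + int j * (2 * int m + 1) < k * int m + int i * (2 * int m + 1)"
      using ik j by (auto simp: dominant_def)
    then show ?thesis using b by cases auto
  qed
next
  case False
  then show ?thesis using j by auto
qed

lemma powers_independent:
  assumes c: "\<And>i. c i \<in> L" and "(\<Sum>i<m. c i * y ^ i) = 0" "j < m"
  shows "c j = 0"
proof (rule ccontr)
  assume "c j \<noteq> 0"
  then have "\<exists>j<m. c j \<noteq> 0" using assms(3) by auto
  from ex_dominant[OF c this] obtain i k where "dominant c i k" by auto
  then show False using wt_nz[OF dominant_wt] assms(2) by blast
qed

lemma ex_wt:
  assumes "z \<noteq> 0"
  shows "\<exists>k. wt z k"
proof -
  obtain i k where "dominant (coord z) i k"
    using ex_dominant[OF coord_L ex_coord_nonzero[OF assms]] by auto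
  then have "wt z (k * int m + int i * (2 * int m + 1))"
    by (subst coord_sum) (rule dominant_wt)
  then show ?thesis ..
qed

text \<open>The place at infinity is rational. For \<open>0 < j\<close> the pole order of
  \<open>c j * y ^ j\<close> is nonzero modulo \<open>m\<close>, hence strictly negative; only
  \<open>c 0\<close> contributes, through its leading coefficient.\<close>

lemma residue:
  assumes "z \<in> R"
  shows "\<exists>c\<in>K. z - c \<in> mx"
proof -
  define c where "c = coord z"
  have c: "\<And>i. c i \<in> L" "z = (\<Sum>i<m. c i * y ^ i)"
    unfolding c_def by (rule coord_L, rule coord_sum)
  have "z = 0 \<or> (\<exists>l\<le>0. wt z l)" using assms ex_wt[of z] wt_mem_iff by auto
  then have "(\<Sum>i<m. c i * y ^ i) = 0 \<or> (\<exists>l\<le>0. wt (\<Sum>i<m. c i * y ^ i) l)"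
    by (simp only: c(2)[symmetric])
  note b = coordinates_bounded[OF c(1) this]
  have small: "c j * y ^ j \<in> mx" if j: "0 < j" "j < m" for j
  proof (cases "c j = 0")
    case False
    then obtain l where l: "has_deg (c j) l" "l * int m + int j * (2 * int m + 1) \<le> 0"
      using b[OF j(2)] by auto
    have "(l * int m + int j * (2 * int m + 1)) mod int m = int j"
    proof -
      have "l * int m + int j * (2 * int m + 1) = int j + (l + 2 * int j) * int m"
        by (simp add: algebra_simps)
      then show ?thesis using that by simp
    qed
    then have "l * int m + int j * (2 * int m + 1) \<noteq> 0" using that by force
    then show ?thesis using l(2) wt_neg[OF wt_term[OF l(1), of j]] by linarith
  qed auto
  have split: "z = c 0 + (\<Sum>j\<in>{..<m} - {0}. c j * y ^ j)"
    using c(2) m2 by (simp add: sum.remove[of "{..<m}" 0])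
  have tail: "(\<Sum>j\<in>{..<m} - {0}. c j * y ^ j) \<in> mx"
    by (intro mx_sum small) auto
  have "\<exists>a\<in>K. c 0 - a \<in> mx"
  proof (cases "c 0 \<in> mx")
    case True
    then show ?thesis using K_closed(2) by (intro bexI[of _ 0]) auto
  next
    case False
    then have "c 0 \<noteq> 0" by auto
    then obtain l where l: "has_deg (c 0) l" "l * int m \<le> 0" using b[of 0] m2 by auto
    then have "l * int m = 0" using False wt_neg[OF has_deg_wt[OF l(1)]] by force
    then have "l = 0" using m2 by simp
    then obtain a e where "a \<in> K" "e \<in> mx" "c 0 = a + e"
      using has_deg_leading_term[OF l(1)] by auto
    then show ?thesis by (intro bexI[of _ a]) auto
  qed
  then obtain a where a: "a \<in> K" "c 0 - a \<in> mx" by auto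
  have "z - a = (c 0 - a) + (\<Sum>j\<in>{..<m} - {0}. c j * y ^ j)" using split by simp
  then have "z - a \<in> mx" using mx_add[OF a(2) tail] by (simp only:)
  then show ?thesis using a(1) by blast
qed

text \<open>Division with remainder: leading terms are split off one by one, with the degree bound
  \<open>N\<close> as induction parameter.\<close>

lemma polynomial_part:
  assumes "z \<in> L"
  shows "\<exists>r\<in>Kx. z - r \<in> mx"
proof -
  have "\<exists>r\<in>Kx. z - r \<in> mx" if "z \<in> L" "z = 0 \<or> (\<exists>k < int N. has_deg z k)" for N z
    using that
  proof (induction N arbitrary: z)
    case 0
    then have "z \<in> mx"
      using m2 wt_neg[OF has_deg_wt] by (fastforce simp: mult_less_0_iff)
    then show ?case using Kx_closed(2) by (intro bexI[of _ 0]) auto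
  next
    case (Suc N)
    show ?case
    proof (cases "z = 0 \<or> (\<exists>k < int N. has_deg z k)")
      case True
      then show ?thesis using Suc by blast
    next
      case False
      then obtain k where "k < int (Suc N)" "has_deg z k" "\<not> k < int N"
        using Suc.prems by blast
      moreover then have "k = int N" by simp
      ultimately have "has_deg z (int N)" by simp
      then obtain c e where ce: "c \<in> K" "e \<in> mx" "z = x ^ N * (c + e)"
        using has_deg_leading_term by force
      define w where "w = z - c * x ^ N"
      have cx: "c * x ^ N \<in> Kx" using ce K_Kx x_Kx by (intro Kx_closed) auto
      have w: "w \<in> L" unfolding w_def using Suc.prems(1) cx Kx_L by (auto intro: L_closed(3))
      have we: "w * inverse (x ^ N) = e"
        using x_nz by (simp add: w_def ce(3) field_simps)
      \<comment> \<open>Dividing \<open>w\<close> by \<open>x ^ N\<close> gives \<open>e\<close>,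
        which vanishes at infinity, so the degree has dropped below \<open>N\<close>.\<close>
      have "w = 0 \<or> (\<exists>k < int N. has_deg w k)"
      proof (cases "w = 0")
        case False
        then obtain l where l: "has_deg w l" using L_has_deg[OF w] by auto
        have "wt e (l * int m + - (int N * int m))"
          using wt_mult[OF has_deg_wt[OF l] wt_inverse[OF wt_power[OF wt_x, of N]]] we by simp
        then have "l * int m + - (int N * int m) < 0" using wt_mx_iff ce(2) by auto
        then have "(l - int N) * int m < 0" by (simp add: algebra_simps)
        then have "l < int N" by (auto simp: mult_less_0_iff)
        then show ?thesis using l by auto
      qed auto
      then obtain r where r: "r \<in> Kx" "w - r \<in> mx" using Suc.IH[OF w] by auto
      have "z - (c * x ^ N + r) = w - r" by (simp add: w_def)
      then have "z - (c * x ^ N + r) \<in> mx" using r(2) by (simp only:)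
      then show ?thesis using Kx_closed(6)[OF cx r(1)] by blast
    qed
  qed
  moreover have "z = 0 \<or> (\<exists>k < int (nat (k0 + 1)). has_deg z k)" if "has_deg z k0" for k0
    using that by (intro disjI2 exI[of _ k0]) auto
  ultimately show ?thesis
    using assms L_has_deg[OF assms] by metis
qed

end

text \<open>The dominant term is read off from the coordinates without reference to the ring, so
  both rings assign the same pole order to every element.\<close>

lemma infinity_unique:
  assumes R: "Y2_infinity n m K x y R" and S: "Y2_infinity n m K x y S"
  shows "R = S"
proof -
  interpret R: Y2_infinity n m K x y R by (rule R)
  interpret S: Y2_infinity n m K x y S by (rule S)
  have "z \<in> R \<longleftrightarrow> z \<in> S" for z
  proof (cases "z = 0")
    case True
    then show ?thesis using subring_zero R.subring S.subring by blast
  next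
    case False
    obtain i k where "R.dominant (R.coord z) i k"
      using R.ex_dominant[OF R.coord_L R.ex_coord_nonzero[OF False]] by auto
    from R.dominant_wt[OF this] S.dominant_wt[OF this]
    obtain l where "R.wt z l" "S.wt z l" unfolding R.coord_sum[of z, symmetric] by blast
    then show ?thesis using R.wt_mem_iff S.wt_mem_iff by simp
  qed
  then show ?thesis by auto
qed

context Y2_infinity
begin

section \<open>The affine coordinate ring is integrally closed\<close>

text \<open>The coefficient vector \<open>c\<close> and the expansions of \<open>y ^ j\<close> in
  powers of \<open>w\<close> are \<open>m + 1\<close> vectors of length \<open>m\<close>, hence
  dependent. In the field the relation involves only powers of \<open>y\<close>, as \<open>c\<close>
  represents zero; their independence leaves a nonzero multiple of \<open>c\<close> equal to
  zero.\<close>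

lemma frobenius_powers_independent:
  assumes c: "\<And>i. c i \<in> L" and sum0: "(\<Sum>i<m. c i * (y ^ 2 ^ e) ^ i) = 0" and i: "i < m"
  shows "c i = 0"
proof -
  define w where "w = y ^ 2 ^ e"
  have "y ^ j \<in> lspan L w" for j
    using lspan_frobenius[OF L_subring h_y_L, of e] lspan_L_eq_UNIV by (auto simp: w_def)
  then have "\<forall>j. \<exists>g. (\<forall>i. g i \<in> L) \<and> y ^ j = (\<Sum>i<m. g i * w ^ i)"
    by (auto simp: lspan_def)
  then obtain g where g: "\<And>j i. g j i \<in> L" "\<And>j. y ^ j = (\<Sum>i<m. g j i * w ^ i)"
    by metis
  have mem: "(if j < m then g j i else c i) \<in> L" for i j using g(1) c by simp
  obtain d where d: "\<forall>j\<in>{..m}. d j \<in> L" "\<exists>j\<in>{..m}. d j \<noteq> 0"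
    "\<forall>i\<in>{..<m}. (\<Sum>j\<le>m. (if j < m then g j i else c i) * d j) = 0"
    using linear_dependence[OF L_subfield, of "{..<m}" "{..m}"
      "\<lambda>i j. if j < m then g j i else c i"] mem by auto
  have row: "(\<Sum>j<m. g j i * d j) + c i * d m = 0" if "i < m" for i
  proof -
    have "(\<Sum>j\<le>m. (if j < m then g j i else c i) * d j) = (\<Sum>j<m. g j i * d j) + c i * d m"
      by (simp flip: lessThan_Suc_atMost)
    then show ?thesis using d(3) that by simp
  qed
  have "(\<Sum>j<m. d j * y ^ j) = (\<Sum>j<m. \<Sum>i<m. g j i * d j * w ^ i)"
    by (simp add: g(2) sum_distrib_left mult_ac)
  also have "\<dots> = (\<Sum>i<m. (\<Sum>j<m. g j i * d j) * w ^ i)"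
    by (subst sum.swap) (simp add: sum_distrib_right)
  also have "\<dots> = (\<Sum>i<m. (c i * d m) * w ^ i)"
  proof (rule sum.cong)
    fix i assume "i \<in> {..<m}"
    then have "(\<Sum>j<m. g j i * d j) = - (c i * d m)"
      using row[of i] by (simp only: eq_neg_iff_add_eq_0 lessThan_iff)
    then show "(\<Sum>j<m. g j i * d j) * w ^ i = (c i * d m) * w ^ i" by (simp add: uminus_eq)
  qed simp
  also have "\<dots> = d m * (\<Sum>i<m. c i * w ^ i)"
    by (simp add: sum_distrib_left mult_ac)
  finally have "(\<Sum>j<m. d j * y ^ j) = 0" using sum0 by (simp add: w_def)
  moreover have "(\<Sum>j<m. (if j < m then d j else 0) * y ^ j) = (\<Sum>j<m. d j * y ^ j)"
    by (rule sum.cong) auto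
  ultimately have dz: "d j = 0" if "j < m" for j
    using powers_independent[of "\<lambda>j. if j < m then d j else 0" j] d(1) that L_closed(2) by auto
  then have "d m \<noteq> 0" using d(2) by (metis atMost_iff order_le_less)
  moreover have "c i * d m = 0" using row[OF i] dz by simp
  ultimately show ?thesis by simp
qed

lemma Kx_wt:
  assumes "u \<in> Kx" "wt u k"
  obtains p where "\<And>i. coeff p i \<in> K" "u = poly p x" "k = int (degree p) * int m"
proof -
  obtain p where p: "\<And>i. coeff p i \<in> K" "u = poly p x" "has_deg u (int (degree p))"
    using Kx_has_deg[OF assms(1) wt_nz[OF assms(2)]] by blast
  then show ?thesis using that wt_unique[OF assms(2) has_deg_wt[OF p(3)]] by blast
qed

text \<open>After removal of the polynomial part the remainder \<open>s\<close> vanishes at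
  infinity. If nonzero, high powers of it outweigh the pole of \<open>b\<close>, and
  \<open>b * s ^ 2 ^ e\<close> would be a polynomial with a zero at infinity.\<close>

lemma Kx_of_bounded_powers:
  assumes z: "z \<in> L" and b: "b \<in> Kx" "b \<noteq> 0" and pow: "\<And>e. b * z ^ 2 ^ e \<in> Kx"
  shows "z \<in> Kx"
proof -
  obtain r where r: "r \<in> Kx" "z - r \<in> mx" using polynomial_part[OF z] by auto
  define s where "s = z - r"
  have s: "s \<in> L" unfolding s_def using z r Kx_L by (auto intro: L_closed(3))
  have bs: "b * s ^ 2 ^ e \<in> Kx" for e
  proof -
    have "s ^ 2 ^ e = z ^ 2 ^ e + r ^ 2 ^ e"
      unfolding s_def minus_eq_plus by (rule add_power_two_power[OF two])
    then have "b * s ^ 2 ^ e = b * z ^ 2 ^ e + b * r ^ 2 ^ e"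
      by (simp only: distrib_left)
    moreover have "b * r ^ 2 ^ e \<in> Kx" using r b by (intro Kx_closed)
    ultimately show ?thesis using Kx_closed(6)[OF pow] by (simp only:)
  qed
  have "s = 0"
  proof (rule ccontr)
    assume nz: "s \<noteq> 0"
    obtain k where k: "wt s k" using ex_wt[OF nz] by auto
    then have k_neg: "k < 0" using r(2) wt_mx_iff s_def by auto
    obtain l where l: "wt b l" using ex_wt[OF b(2)] by auto
    \<comment> \<open>Large enough, because \<open>l < 2 ^ nat l\<close>.\<close>
    define e where "e = nat l"
    have w: "wt (b * s ^ 2 ^ e) (l + int (2 ^ e) * k)"
      by (rule wt_mult[OF l wt_power[OF k]])
    obtain p where "l + int (2 ^ e) * k = int (degree (p :: 'a poly)) * int m"
      using Kx_wt[OF bs w] by metis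
    then have "0 \<le> l + int (2 ^ e) * k" by simp
    moreover have "int (2 ^ e) * k \<le> int (2 ^ e) * (- 1)"
      using k_neg by (intro mult_left_mono) auto
    moreover have "l < int (2 ^ e)"
    proof -
      have "e < 2 ^ e" by (rule less_exp)
      then have "int e < int (2 ^ e)" by (simp only: of_nat_less_iff)
      then show ?thesis unfolding e_def by linarith
    qed
    ultimately show False by linarith
  qed
  then show ?thesis using r(1) s_def by simp
qed

lemma common_denominator: "\<exists>d\<in>Kx. d \<noteq> 0 \<and> d * z \<in> lspan Kx y"
proof -
  define c where "c = coord z"
  have c: "\<And>i. c i \<in> L" "z = (\<Sum>i<m. c i * y ^ i)"
    unfolding c_def by (rule coord_L, rule coord_sum)
  have "\<forall>i. \<exists>v\<in>Kx. v \<noteq> 0 \<and> v * c i \<in> Kx"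
  proof
    fix i
    obtain u v where "c i = u / v" "u \<in> Kx" "v \<in> Kx" "v \<noteq> 0" using c(1)[of i] by (auto simp: L_def)
    then show "\<exists>v\<in>Kx. v \<noteq> 0 \<and> v * c i \<in> Kx" by (intro bexI[of _ v]) auto
  qed
  then obtain v where v: "\<And>i. v i \<in> Kx" "\<And>i. v i \<noteq> 0" "\<And>i. v i * c i \<in> Kx" by metis
  define d where "d = (\<Prod>i<m. v i)"
  have prod: "(\<Prod>i\<in>I. v i) \<in> Kx" for I
    by (induction I rule: infinite_finite_induct) (auto intro: Kx_closed v)
  have dc: "d * c i \<in> Kx" if "i < m" for i
  proof -
    have "d * c i = (\<Prod>i\<in>{..<m} - {i}. v i) * (v i * c i)"
      unfolding d_def using that by (simp add: prod.remove[of "{..<m}" i])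
    then show ?thesis using Kx_closed(4)[OF prod v(3)] by (simp only:)
  qed
  note A = lspan_subring[OF Kx_subring h_y_Kx] lspan_base[OF Kx_subring h_y_Kx]
    lspan_gen[OF Kx_subring h_y_Kx]
  have "d * z = (\<Sum>i<m. (d * c i) * y ^ i)"
    by (simp add: c(2) sum_distrib_left mult.assoc)
  also have "\<dots> \<in> lspan Kx y"
  proof (rule subring_sum[OF A(1)])
    fix i assume "i \<in> {..<m}"
    then have "d * c i \<in> lspan Kx y" using dc A(2) by auto
    then show "(d * c i) * y ^ i \<in> lspan Kx y"
      by (rule subring_mult[OF A(1) _ subring_power[OF A(1,3)]])
  qed
  finally show ?thesis using prod v(2) by (intro bexI[of _ d]) (auto simp: d_def)
qed

text \<open>If \<open>b * z ^ 2 ^ e\<close> lies in \<open>K[x, y]\<close> for all \<open>e\<close>, compare coordinates with respect to the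
  powers of \<open>y ^ 2 ^ e\<close>: the coordinates of \<open>z ^ 2 ^ e\<close> are the \<open>2 ^ e\<close>-th powers of those of \<open>z\<close>.\<close>

lemma coordinate_ring_integrally_closed:
  assumes val: "\<And>T. valuation_subring T \<Longrightarrow> lspan Kx y \<subseteq> T \<Longrightarrow> z \<in> T"
  shows "z \<in> lspan Kx y"
proof (cases "z = 0")
  case True
  then show ?thesis using lspan_zero[OF Kx_subring h_y_Kx] by simp
next
  case False
  define A where "A = lspan Kx y"
  have A: "is_subring A" "Kx \<subseteq> A" "y \<in> A"
    unfolding A_def using lspan_subring lspan_base lspan_gen Kx_subring h_y_Kx by blast+
  \<comment> \<open>An integral equation for \<open>z\<close>, divided by a power of
    \<open>z\<close>. If it failed, some valuation ring over \<open>A\<close> would miss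
    \<open>z\<close>.\<close>
  have "z \<in> poly_ring A (inverse z)"
  proof (rule ccontr)
    assume "z \<notin> poly_ring A (inverse z)"
    then obtain T where "valuation_subring T" "poly_ring A (inverse z) \<subseteq> T" "z \<notin> T"
      using valuation_ring_missing_exists[OF poly_ring_subring[OF A(1)] poly_ring_gen[OF A(1)]]
      by blast
    then show False using val poly_ring_base[OF A(1), of "inverse z"] by (auto simp: A_def)
  qed
  then obtain a N where a: "\<And>i. a i \<in> A" and zsum: "z = (\<Sum>i\<le>(N::nat). a i * inverse z ^ i)"
    by (rule poly_ring_sum) blast
  obtain d where d: "d \<in> Kx" "d \<noteq> 0" "d * z \<in> A" using common_denominator[of z] by (auto simp: A_def)
  \<comment> \<open>The factor \<open>d ^ N\<close> clears the denominators of \<open>z ^ k\<close>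
    for \<open>k \<le> N\<close>; the integral equation reduces higher powers to lower ones.\<close>
  define b where "b = d ^ N"
  have b: "b \<in> Kx" "b \<noteq> 0" using d by (auto simp: b_def intro: Kx_closed)
  have bz: "b * z ^ k \<in> A" for k
  proof (induction k rule: less_induct)
    case (less k)
    show ?case
    proof (cases "k \<le> N")
      case True
      have "b * z ^ k = d ^ (N - k) * (d * z) ^ k"
        using True by (simp add: b_def power_mult_distrib flip: mult.assoc power_add)
      then show ?thesis using d A by (auto intro!: subring_closed[OF A(1)])
    next
      case False
      then obtain k' where k': "k = Suc k'" "N \<le> k'" by (cases k) auto
      have "z ^ k = (\<Sum>i\<le>N. a i * inverse z ^ i) * z ^ k'"
        using zsum k' by simp
      also have "\<dots> = (\<Sum>i\<le>N. a i * z ^ (k' - i))"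
        unfolding sum_distrib_right using k' \<open>z \<noteq> 0\<close>
        by (intro sum.cong) (auto simp: power_inverse power_diff divide_inverse mult_ac)
      finally have "b * z ^ k = (\<Sum>i\<le>N. a i * (b * z ^ (k' - i)))"
        by (simp add: sum_distrib_left mult_ac)
      moreover have "b * z ^ (k' - i) \<in> A" for i using less.IH[of "k' - i"] k' by simp
      ultimately show ?thesis
        using subring_sum[OF A(1), of "{..N}" "\<lambda>i. a i * (b * z ^ (k' - i))"]
          subring_mult[OF A(1) a] by (simp only:)
    qed
  qed
  define c where "c = coord z"
  have c: "\<And>i. c i \<in> L" "z = (\<Sum>i<m. c i * y ^ i)"
    unfolding c_def by (rule coord_L, rule coord_sum)
  have bc: "b * c i ^ 2 ^ e \<in> Kx" if i: "i < m" for i e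
  proof -
    have "b * z ^ 2 ^ e \<in> lspan Kx (y ^ 2 ^ e)"
      using bz[of "2 ^ e"] lspan_frobenius[OF Kx_subring h_y_Kx, of e] by (auto simp: A_def)
    then obtain f where f: "\<And>i. f i \<in> Kx" "b * z ^ 2 ^ e = (\<Sum>i<m. f i * (y ^ 2 ^ e) ^ i)"
      by (auto simp: lspan_def)
    have "z ^ 2 ^ e = (\<Sum>i<m. (c i * y ^ i) ^ 2 ^ e)"
      unfolding c(2) by (rule sum_power_two_power[OF two])
    also have "\<dots> = (\<Sum>i<m. c i ^ 2 ^ e * (y ^ 2 ^ e) ^ i)"
      by (simp add: power_mult_distrib mult.commute flip: power_mult)
    finally have "b * z ^ 2 ^ e = (\<Sum>i<m. (b * c i ^ 2 ^ e) * (y ^ 2 ^ e) ^ i)"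
      by (simp add: sum_distrib_left mult.assoc)
    then have "(\<Sum>i<m. (b * c i ^ 2 ^ e - f i) * (y ^ 2 ^ e) ^ i) = 0"
      using f(2) by (simp only: left_diff_distrib sum_subtractf diff_self)
    moreover have "b * c i ^ 2 ^ e - f i \<in> L" for i
      by (intro L_closed c) (use b f Kx_L in auto)
    ultimately have "b * c i ^ 2 ^ e - f i = 0"
      using frobenius_powers_independent[of "\<lambda>i. b * c i ^ 2 ^ e - f i" e i] i by simp
    then show ?thesis using f(1)[of i] by simp
  qed
  have "c i \<in> Kx" if "i < m" for i
    by (rule Kx_of_bounded_powers[OF c(1) b bc[OF that]])
  then have "(\<Sum>i<m. c i * y ^ i) \<in> A"
    using A by (auto intro!: subring_sum[OF A(1)] subring_mult[OF A(1)] subring_power[OF A(1)])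
  then show ?thesis using c(2) by (simp add: A_def)
qed

end

section \<open>Automorphisms\<close>

locale field_automorphism =
  fixes K :: "'a::field set" and \<sigma> :: "'a \<Rightarrow> 'a"
  assumes aut: "\<sigma> \<in> field_aut K"
begin

lemma bij: "bij \<sigma>"
  and add: "\<sigma> (a + b) = \<sigma> a + \<sigma> b"
  and mult: "\<sigma> (a * b) = \<sigma> a * \<sigma> b"
  and fix_K: "c \<in> K \<Longrightarrow> \<sigma> c = c"
  using aut by (auto simp: field_aut_def)

lemma inj: "\<sigma> a = \<sigma> b \<longleftrightarrow> a = b"
  using bij by (auto simp: bij_def inj_def)

lemma zero: "\<sigma> 0 = 0"
  using add[of 0 0] by (metis add.right_neutral add_left_cancel)

lemma one: "\<sigma> 1 = 1"
  using mult[of 1 1] inj[of 1 0] by (simp add: zero)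

lemma diff: "\<sigma> (a - b) = \<sigma> a - \<sigma> b"
  using add[of "a - b" b] by (simp add: algebra_simps)

lemma inverse: "\<sigma> (inverse a) = inverse (\<sigma> a)"
proof (cases "a = 0")
  case False
  then have "\<sigma> a * \<sigma> (inverse a) = 1" by (simp flip: mult add: one)
  then show ?thesis by (metis inverse_unique)
qed (simp add: zero)

lemma power: "\<sigma> (a ^ k) = \<sigma> a ^ k"
  by (induction k) (auto simp: one mult)

lemma image_iff: "\<sigma> a \<in> \<sigma> ` R \<longleftrightarrow> a \<in> R"
  using inj by auto

lemma surj: obtains b where "a = \<sigma> b"
  using bij by (auto simp: bij_def surj_def)

lemma image_valuation:
  assumes "valuation_subring R"
  shows "valuation_subring (\<sigma> ` R)"
proof -
  interpret valuation_subring R by fact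
  show ?thesis
  proof
    show "is_subring (\<sigma> ` R)"
      unfolding is_subring_def
    proof (intro conjI ballI)
      show "1 \<in> \<sigma> ` R" using subring_one[OF subring] one by force
      fix a b assume "a \<in> \<sigma> ` R" "b \<in> \<sigma> ` R"
      then obtain u v where "a = \<sigma> u" "b = \<sigma> v" "u \<in> R" "v \<in> R" by auto
      then show "a - b \<in> \<sigma> ` R" "a * b \<in> \<sigma> ` R"
        by (auto simp flip: diff mult intro!: imageI subring_diff[OF subring] subring_mult[OF subring])
    qed
    show "z \<in> \<sigma> ` R \<or> inverse z \<in> \<sigma> ` R" for z
      using surj[of z] total by (metis inverse imageI)
  qed
qed

lemma K_subset_image: "K \<subseteq> R \<Longrightarrow> K \<subseteq> \<sigma> ` R"
  using fix_K by (metis image_eqI subset_eq)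

lemma mx_image:
  assumes "valuation_subring R"
  shows "\<sigma> a \<in> valuation_subring.mx (\<sigma> ` R) \<longleftrightarrow> a \<in> valuation_subring.mx R"
  using inj[of a 0]
  by (simp add: valuation_subring.mx_def[OF assms] valuation_subring.mx_def[OF image_valuation[OF assms]]
      zero image_iff flip: inverse)

lemma inv_aut: "field_automorphism K (inv \<sigma>)"
proof
  have i: "inv \<sigma> (\<sigma> a) = a" for a using bij by (simp add: bij_def)
  have "inv \<sigma> (a + b) = inv \<sigma> a + inv \<sigma> b" "inv \<sigma> (a * b) = inv \<sigma> a * inv \<sigma> b" for a b
    using surj[of a] surj[of b] by (metis add mult i)+
  moreover have "inv \<sigma> c = c" if "c \<in> K" for c
    using i[of c] fix_K[OF that] by simp
  ultimately show "inv \<sigma> \<in> field_aut K"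
    using bij_imp_bij_inv[OF bij] by (simp add: field_aut_def)
qed

end

section \<open>Additivity of the defining polynomial and translation of points\<close>

context Y2_field
begin

lemma h_add: "Y2_h n (a + b) = Y2_h n a + Y2_h n (b::'a)"
  by (simp add: Y2_h_def add_power_two_power[OF two] sum.distrib)

lemma h_telescope: "Y2_h n (t\<^sup>2) + Y2_h n t = t ^ 2 ^ n + (t::'a)"
proof -
  have "(\<Sum>i<N. (t\<^sup>2) ^ 2 ^ i) + (\<Sum>i<N. t ^ 2 ^ i) = t ^ 2 ^ N + t" for N
  proof (induction N)
    case 0
    then show ?case by (simp add: add_self)
  next
    case (Suc N)
    have "(\<Sum>i<Suc N. (t\<^sup>2) ^ 2 ^ i) + (\<Sum>i<Suc N. t ^ 2 ^ i)
        = (t\<^sup>2) ^ 2 ^ N + (((\<Sum>i<N. (t\<^sup>2) ^ 2 ^ i) + (\<Sum>i<N. t ^ 2 ^ i)) + t ^ 2 ^ N)"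
      by (simp add: add_ac)
    also have "\<dots> = (t\<^sup>2) ^ 2 ^ N + (t + (t ^ 2 ^ N + t ^ 2 ^ N))"
      unfolding Suc.IH by (simp only: add_ac)
    also have "\<dots> = t ^ 2 ^ Suc N + t"
      by (simp add: add_self flip: power_mult)
    finally show ?case .
  qed
  then show ?thesis by (simp add: Y2_h_def)
qed

text \<open>These substitutions move the affine rational point \<open>(a, b)\<close> to the origin.\<close>

lemma translate:
  assumes a: "a \<in> K" and b: "b \<in> K" and hb: "Y2_h n b = a ^ (2 * m + 1)"
  shows "Y2_field n m K (x + a) (y + b + ((a ^ (2 * m) * (x + a))\<^sup>2 + a ^ (2 * m) * (x + a)))"
    (is "Y2_field n m K ?x ?y")
proof
  define A where "A = a ^ (2 * m)"
  \<comment> \<open>Adding \<open>t\<^sup>2 + t\<close> to \<open>y\<close> adds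
    \<open>t ^ (2 * m) + t\<close> to \<open>Y2_h n y\<close>; this choice of \<open>t\<close>
    supplies exactly the mixed terms of \<open>(x + a) ^ (2 * m + 1)\<close>.\<close>
  define t where "t = A * (x + a)"
  have q: "(u + v) ^ (2 * m) = u ^ (2 * m) + v ^ (2 * m)" for u v :: 'a
    using add_power_two_power[OF two, of u v n] by (simp only: two_power_n)
  \<comment> \<open>The field \<open>K\<close> has \<open>(2 * m)\<^sup>2\<close> elements, so the
    power map with exponent \<open>2 * m\<close> is an involution on it.\<close>
  have "a ^ ((2 * m) * (2 * m)) = a"
    using subfield_power_card[OF K finite_K a] by (simp add: cardK two_power_n power2_eq_square)
  then have "A ^ (2 * m) = a" by (simp only: A_def power_mult)
  then have tq: "t ^ (2 * m) = a * (x ^ (2 * m) + A)"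
    by (simp only: t_def power_mult_distrib q) (simp add: A_def)
  have "Y2_h n ?y = Y2_h n y + Y2_h n b + (t ^ (2 * m) + t)"
    unfolding h_add A_def[symmetric] t_def[symmetric] h_telescope two_power_n ..
  also have "\<dots> = x ^ (2 * m) * x + A * a + (a * (x ^ (2 * m) + A) + A * (x + a))"
    unfolding h_y hb tq by (simp add: t_def A_def mult.commute)
  also have "\<dots> = (x ^ (2 * m) + A) * (x + a) + (A * a + A * a)"
    by (simp add: algebra_simps)
  also have "\<dots> = ?x ^ (2 * m + 1)"
    unfolding add_self A_def power_add q by simp
  finally show "Y2_h n ?y = ?x ^ (2 * m + 1)" .
  show "field_adjoin K {?x, ?y} = UNIV"
  proof -
    have "F = UNIV" if F: "is_subfield F" "K \<subseteq> F" "{?x, ?y} \<subseteq> F" for F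
    proof -
      note Fr = subring_closed[OF subfield_subring[OF F(1)]]
      have ab: "a \<in> F" "b \<in> F" "x + a \<in> F" using a b F by auto
      have "x = ?x - a" by simp
      then have x: "x \<in> F" using Fr(3)[OF ab(3,1)] by (simp only:)
      have c: "b + ((a ^ (2 * m) * (x + a))\<^sup>2 + a ^ (2 * m) * (x + a)) \<in> F"
        using ab x by (intro Fr(4,6,7)) auto
      have "y = ?y - (b + ((a ^ (2 * m) * (x + a))\<^sup>2 + a ^ (2 * m) * (x + a)))" by simp
      moreover have "?y \<in> F" using F(3) by simp
      ultimately have "y \<in> F" using Fr(3)[OF _ c] by metis
      then have "field_adjoin K {x, y} \<subseteq> F"
        unfolding field_adjoin_def using F x by blast
      then show ?thesis using adjoin by auto
    qed
    then show ?thesis unfolding field_adjoin_def by blast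
  qed
qed (rule n2 m_def K cardK)+

end

section \<open>Functions of small pole order at infinity\<close>

context Y2_infinity
begin

lemma Kx_degree_le_2:
  assumes "u \<in> Kx" "u = 0 \<or> (\<exists>l\<le>2. has_deg u l)"
  shows "\<exists>a\<in>K. \<exists>b\<in>K. \<exists>c\<in>K. u = a + b * x + c * x ^ 2"
proof (cases "u = 0")
  case True
  then show ?thesis using K_closed(2) by (intro bexI[of _ 0]) auto
next
  case False
  then obtain l where l: "l \<le> 2" "has_deg u l" using assms by auto
  obtain p where p: "\<And>i. coeff p i \<in> K" "u = poly p x" "l * int m = int (degree p) * int m"
    using Kx_wt[OF assms(1) has_deg_wt[OF l(2)]] by blast
  then have "degree p \<le> 2" using l(1) m2 by auto
  then have "poly p x = (\<Sum>i\<le>2. coeff p i * x ^ i)"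
    unfolding poly_altdef by (intro sum.mono_neutral_left) (auto simp: coeff_eq_0)
  then have "u = coeff p 0 + coeff p 1 * x + coeff p 2 * x ^ 2"
    using p(2) by (simp add: numeral_2_eq_2)
  then show ?thesis using p(1) by blast
qed

lemma Kx_degree_0:
  assumes "u \<in> Kx" "u = 0 \<or> (\<exists>l\<le>0. has_deg u l)"
  shows "u \<in> K"
proof (cases "u = 0")
  case True
  then show ?thesis using K_closed(2) by simp
next
  case False
  then obtain l where l: "l \<le> 0" "has_deg u l" using assms by auto
  obtain p where p: "\<And>i. coeff p i \<in> K" "u = poly p x" "l * int m = int (degree p) * int m"
    using Kx_wt[OF assms(1) has_deg_wt[OF l(2)]] by blast
  then have "degree p = 0" using l(1) m2 by auto
  then have "u = coeff p 0" using p(2) by (simp add: poly_altdef)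
  then show ?thesis using p(1) by simp
qed

text \<open>With polynomial coordinates the monomials have pole orders
  \<open>l * m + j * (2 * m + 1)\<close> with \<open>0 \<le> l\<close>; those within the bound are
  \<open>1\<close>, \<open>x\<close>, \<open>x ^ 2\<close> and \<open>y\<close>.\<close>

lemma small_pole_order:
  assumes z: "z \<in> lspan Kx y" and w: "z = 0 \<or> (\<exists>l\<le>2 * int m + 1. wt z l)"
  shows "\<exists>a\<in>K. \<exists>b\<in>K. \<exists>c\<in>K. \<exists>d\<in>K. z = a + b * x + c * x ^ 2 + d * y"
proof -
  obtain c where c: "\<And>i. c i \<in> Kx" "(\<Sum>i<m. c i * y ^ i) = z"
    using z unfolding lspan_def by auto
  have cL: "c i \<in> L" for i using c(1) Kx_L by auto
  have bd: "c j = 0 \<or> (\<exists>l. has_deg (c j) l \<and> l * int m + int j * (2 * int m + 1) \<le> 2 * int m + 1)"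
    if "j < m" for j
    by (rule coordinates_bounded[OF cL _ that]) (unfold c(2), rule w)
  have nonneg: "0 \<le> l" if hd: "has_deg (c j) l" for j l
  proof -
    obtain p where "l * int m = int (degree (p::'a poly)) * int m"
      using Kx_wt[OF c(1) has_deg_wt[OF hd]] by blast
    then show ?thesis using m2 by auto
  qed
  have c_ge_2: "c j = 0" if "2 \<le> j" "j < m" for j
  proof (rule ccontr)
    assume "c j \<noteq> 0"
    then obtain l where l: "has_deg (c j) l" "l * int m + int j * (2 * int m + 1) \<le> 2 * int m + 1"
      using bd[of j] \<open>j < m\<close> by auto
    have "2 * (2 * int m + 1) \<le> int j * (2 * int m + 1)"
      using that by (intro mult_right_mono) auto
    moreover have "0 \<le> l * int m" using nonneg[OF l(1)] by simp
    ultimately have "2 * (2 * int m + 1) \<le> 2 * int m + 1" using l(2) by linarith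
    then show False using m2 by simp
  qed
  have "c 1 = 0 \<or> (\<exists>l\<le>0. has_deg (c 1) l)"
  proof (cases "c 1 = 0")
    case False
    then obtain l where l: "has_deg (c 1) l" "l * int m \<le> 0" using bd[of 1] m2 by auto
    then have "l \<le> 0" using m2 by (simp add: mult_le_0_iff)
    then show ?thesis using l by auto
  qed simp
  then have c1: "c 1 \<in> K" by (rule Kx_degree_0[OF c(1)])
  have "c 0 = 0 \<or> (\<exists>l\<le>2. has_deg (c 0) l)"
  proof (cases "c 0 = 0")
    case False
    then obtain l where l: "has_deg (c 0) l" "l * int m \<le> 2 * int m + 1" using bd[of 0] m2 by auto
    have "l \<le> 2"
    proof (rule ccontr)
      assume "\<not> l \<le> 2"
      \<comment> \<open>Here \<open>m \<ge> 2\<close> matters: it makes \<open>3 * m\<close> exceed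
        \<open>2 * m + 1\<close>.\<close>
      then have "3 * int m \<le> l * int m" by (intro mult_right_mono) auto
      then show False using l(2) m2 by linarith
    qed
    then show ?thesis using l by auto
  qed simp
  from Kx_degree_le_2[OF c(1) this] obtain a0 a1 a2 where
    a: "a0 \<in> K" "a1 \<in> K" "a2 \<in> K" "c 0 = a0 + a1 * x + a2 * x ^ 2" by auto
  have "(\<Sum>i<m. c i * y ^ i) = (\<Sum>i<2. c i * y ^ i)"
    using m2 c_ge_2 by (intro sum.mono_neutral_right) auto
  also have "\<dots> = a0 + a1 * x + a2 * x ^ 2 + c 1 * y" by (simp add: numeral_2_eq_2 a(4))
  finally show ?thesis using a c1 c(2) by blast
qed

lemma infinity_ringI:
  assumes "valuation_subring T" "K \<subseteq> T" "x \<notin> T"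
  shows "Y2_infinity n m K x y T"
  using assms Y2_field_axioms by (auto simp: Y2_infinity_def Y2_infinity_axioms_def)

end

section \<open>The image of the place at infinity\<close>

locale Y2_automorphism = Y2_infinity n m K x y R + field_automorphism K \<sigma>
  for n m :: nat and K :: "'a::field set" and x y :: 'a and R :: "'a set" and \<sigma> :: "'a \<Rightarrow> 'a"
begin

sublocale S: valuation_subring "\<sigma> ` R"
  by (rule image_valuation) unfold_locales

lemma K_mx_S:
  assumes "c \<in> K" "c \<in> S.mx"
  shows "c = 0"
proof (rule ccontr)
  assume "c \<noteq> 0"
  then have "inverse c \<in> \<sigma> ` R"
    using assms(1) K_subset_image[OF K_sub] subfield_inverse[OF K] by auto
  then show False using assms(2) \<open>c \<noteq> 0\<close> by (simp add: S.mx_def)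
qed

text \<open>Pulled back along \<open>inv \<sigma>\<close>, a pole of \<open>\<sigma> x\<close>
  becomes a pole of \<open>x\<close>, and there is only one of those.\<close>

lemma pole_of_image:
  assumes T: "valuation_subring T" "K \<subseteq> T" and f: "\<sigma> x \<notin> T"
  shows "T = \<sigma> ` R"
proof -
  interpret inv: field_automorphism K "inv \<sigma>" by (rule inv_aut)
  have i: "inv \<sigma> (\<sigma> a) = a" "\<sigma> (inv \<sigma> a) = a" for a
    using bij by (simp_all add: bij_def surj_f_inv_f)
  have "x \<notin> inv \<sigma> ` T" using f i inv.image_iff[of "\<sigma> x" T] by simp
  then have "Y2_infinity n m K x y (inv \<sigma> ` T)"
    by (intro infinity_ringI inv.image_valuation inv.K_subset_image T)
  then have "inv \<sigma> ` T = R" using infinity_unique Y2_infinity_axioms by blast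
  then have "\<sigma> ` R = \<sigma> ` inv \<sigma> ` T" by simp
  then show ?thesis by (simp add: image_image i)
qed

text \<open>With \<open>f = \<sigma> x\<close>, the divisor of \<open>y\<close> being \<open>2 * m + 1\<close> times (origin minus infinity), the function
  \<open>f * y\<close> has at most a pole of order \<open>2 * m + 1\<close> at infinity and no other pole, and vanishes to order
  at least \<open>m + 1\<close> at the origin.\<close>

lemma not_origin:
  assumes x: "x \<in> S.mx" and y: "y \<in> S.mx"
  shows False
proof -
  define f where "f = \<sigma> x"
  \<comment> \<open>The preimage \<open>s\<close> of \<open>x\<close> vanishes at infinity, so
    \<open>s ^ m\<close> cancels the pole of \<open>x\<close> of order \<open>m\<close> there;
    applying \<open>\<sigma>\<close> transports this to the origin.\<close>
  have fx: "f * x ^ m \<in> \<sigma> ` R"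
  proof -
    obtain s where s: "x = \<sigma> s" by (rule surj)
    have smx: "s \<in> mx" using x mx_image[OF valuation_subring_axioms, of s] s by simp
    have "s \<noteq> 0" using s zero x_nz by auto
    then obtain k where k: "wt s k" using ex_wt by auto
    have "k < 0" using k smx wt_mx_iff by auto
    have "wt (x * s ^ m) (int m + int m * k)" by (rule wt_mult[OF wt_x wt_power[OF k]])
    moreover have "int m + int m * k \<le> 0"
    proof -
      have "int m * k \<le> int m * (- 1)" using \<open>k < 0\<close> by (intro mult_left_mono) auto
      then show ?thesis by simp
    qed
    ultimately have "x * s ^ m \<in> R" using wt_mem_iff by auto
    moreover have "f * x ^ m = \<sigma> (x * s ^ m)" by (simp add: f_def mult power flip: s)
    ultimately show ?thesis by simp
  qed
  \<comment> \<open>The cofactor in \<open>Y2_h n y = y * u\<close>, a unit at the origin; hence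
    \<open>y\<close> is a unit times \<open>x ^ (2 * m + 1)\<close> there.\<close>
  define u where "u = 1 + (\<Sum>i<n - 1. y ^ (2 ^ Suc i - 1))"
  have "S.unit u"
    unfolding u_def
  proof (intro S.unit_add_mx S.mx_sum S.mx_power y)
    show "S.unit 1" by (simp add: S.unit_def subring_one[OF S.subring])
    fix i
    have "(1::nat) < 2 ^ Suc i" by (rule one_less_power) simp_all
    then show "0 < (2::nat) ^ Suc i - 1" by linarith
  qed
  then have u: "u \<noteq> 0" "inverse u \<in> \<sigma> ` R" by (auto simp: S.unit_def)
  have "y * y ^ (2 ^ Suc i - 1) = (y\<^sup>2) ^ 2 ^ i" for i
  proof -
    have "Suc (2 ^ Suc i - 1) = 2 * 2 ^ i" by simp
    then show ?thesis by (metis power_Suc power_mult)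
  qed
  then have "y * u = x ^ (2 * m + 1)"
    unfolding u_def h_y[symmetric] Y2_h_eq' by (simp add: distrib_left sum_distrib_left)
  then have yu: "y = inverse u * x ^ (2 * m + 1)"
    using u(1) by (simp add: field_simps)
  have xS: "x \<in> \<sigma> ` R" using x by (rule S.mx_subset)
  define s where "s = inverse u * x ^ (2 * m - 2)"
  have s: "s \<in> \<sigma> ` R" "y = s * x ^ 3"
  proof -
    show "s \<in> \<sigma> ` R" unfolding s_def using u xS by (intro subring_closed[OF S.subring])
    have "2 * m + 1 = (2 * m - 2) + 3" using m2 by simp
    then show "y = s * x ^ 3" unfolding s_def by (metis mult.assoc power_add yu)
  qed
  \<comment> \<open>The exponent splits as \<open>m + (m - 2) + 3\<close>: the first part absorbs
    the pole of \<open>f\<close>, and the cube of \<open>x\<close> is what remains.\<close>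
  define r where "r = (f * x ^ m) * inverse u * x ^ (m - 2)"
  have r: "r \<in> \<sigma> ` R" "f * y = r * x ^ 3"
  proof -
    show "r \<in> \<sigma> ` R"
      unfolding r_def by (intro subring_mult[OF S.subring fx, THEN subring_mult[OF S.subring]]
          subring_power[OF S.subring] u xS)
    have "2 * m + 1 = m + (m - 2) + 3" using m2 by simp
    then have "x ^ (2 * m + 1) = x ^ m * x ^ (m - 2) * x ^ 3" by (simp only: power_add)
    then show "f * y = r * x ^ 3" unfolding r_def by (subst yu) (simp only: mult_ac)
  qed
  have "f \<in> R"
  proof (rule ccontr)
    assume "f \<notin> R"
    then have "R = \<sigma> ` R"
      using pole_of_image[OF valuation_subring_axioms K_sub] by (simp add: f_def)
    then show False using xS x_pole by simp
  qed
  have "f \<noteq> 0" using x_nz inj[of x 0] by (simp add: f_def zero)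
  \<comment> \<open>A valuation ring over the coordinate ring contains \<open>f\<close>, or is the
    image ring, where the zero of \<open>y\<close> absorbs the pole of \<open>f\<close>.\<close>
  have "f * y \<in> lspan Kx y"
  proof (rule coordinate_ring_integrally_closed)
    fix T assume T: "valuation_subring T" "lspan Kx y \<subseteq> T"
    then have Tr: "is_subring T" by (simp add: valuation_subring_def)
    have KT: "K \<subseteq> T" and yT: "y \<in> T"
      using T(2) K_Kx lspan_base[OF Kx_subring h_y_Kx] lspan_gen[OF Kx_subring h_y_Kx] by auto
    show "f * y \<in> T"
    proof (cases "f \<in> T")
      case True
      then show ?thesis using yT by (rule subring_mult[OF Tr])
    next
      case False
      then have "T = \<sigma> ` R" using pole_of_image[OF T(1) KT] by (simp add: f_def)
      moreover have "f * y \<in> \<sigma> ` R" unfolding r(2)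
        using r(1) xS by (intro subring_closed[OF S.subring])
      ultimately show ?thesis by simp
    qed
  qed
  moreover have "\<exists>l\<le>2 * int m + 1. wt (f * y) l"
  proof -
    obtain k where k: "wt f k" using ex_wt[OF \<open>f \<noteq> 0\<close>] by auto
    then have "k \<le> 0" using \<open>f \<in> R\<close> wt_mem_iff by auto
    then show ?thesis using wt_mult[OF k wt_y] by (intro exI[of _ "k + (2 * int m + 1)"]) auto
  qed
  ultimately obtain a b c d where abcd: "a \<in> K" "b \<in> K" "c \<in> K" "d \<in> K"
    "f * y = a + b * x + c * x ^ 2 + d * y"
    using small_pole_order[of "f * y"] by blast
  \<comment> \<open>With \<open>y\<close> and \<open>f * y\<close> both divisible by
    \<open>x ^ 3\<close>, the constants \<open>a\<close>, \<open>b\<close>, \<open>c\<close> turn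
    out in succession to be multiples of \<open>x\<close> at the origin, hence zero.\<close>
  define e where "e = r - d * s"
  have dS: "d \<in> \<sigma> ` R" "b \<in> \<sigma> ` R" "c \<in> \<sigma> ` R" using abcd K_subset_image[OF K_sub] by auto
  have e: "e \<in> \<sigma> ` R" unfolding e_def using r s dS by (intro subring_closed[OF S.subring])
  have "a + b * x + c * x ^ 2 = f * y - d * y" using abcd(5) by simp
  also have "\<dots> = r * x ^ 3 - d * (s * x ^ 3)" unfolding r(2) by (simp only: s(2)[symmetric])
  also have "\<dots> = e * x ^ 3" unfolding e_def by (simp add: algebra_simps)
  finally have 0: "a + b * x + c * x ^ 2 = e * x ^ 3" .
  have "a = (e * x ^ 2 - b - c * x) * x"
    using 0 by (simp add: algebra_simps power2_eq_square power3_eq_cube)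
  also have "\<dots> \<in> S.mx"
    using e xS dS x by (intro S.mx_mult subring_closed[OF S.subring])
  finally have a0: "a = 0" using K_mx_S abcd(1) by auto
  then have "(b + c * x) * x = (e * x ^ 2) * x"
    using 0 by (simp add: algebra_simps power2_eq_square power3_eq_cube)
  then have 1: "b + c * x = e * x ^ 2" using x_nz by simp
  have "b = (e * x - c) * x"
    using 1 by (simp add: algebra_simps power2_eq_square)
  also have "\<dots> \<in> S.mx"
    using e xS dS x by (intro S.mx_mult subring_closed[OF S.subring])
  finally have b0: "b = 0" using K_mx_S abcd(2) by auto
  then have "c * x = (e * x) * x" using 1 by (simp add: power2_eq_square)
  then have "c = e * x" using x_nz by simp
  also have "\<dots> \<in> S.mx" using e x by (rule S.mx_mult)
  finally have "c = 0" using K_mx_S abcd(3) by auto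
  then have "f * y = d * y" using abcd(5) a0 b0 by simp
  then have "\<sigma> x = \<sigma> d" using y_nz fix_K[OF abcd(4)] by (simp add: f_def)
  then have "x \<in> K" using inj abcd(4) by simp
  then show False using K_sub x_pole by auto
qed

lemma residue_S:
  assumes "z \<in> \<sigma> ` R"
  shows "\<exists>c\<in>K. z + c \<in> S.mx"
proof -
  obtain s where s: "z = \<sigma> s" "s \<in> R" using assms by auto
  obtain c where c: "c \<in> K" "s - c \<in> mx" using residue[OF s(2)] by auto
  have "\<sigma> (s - c) \<in> S.mx" using c(2) mx_image[OF valuation_subring_axioms] by simp
  then have "z - c \<in> S.mx" using s fix_K[OF c(1)] by (simp add: diff)
  then show ?thesis using c(1) by (auto simp: minus_eq_plus)
qed

lemma image_infinity: "\<sigma> ` R = R"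
proof (rule ccontr)
  assume ne: "\<sigma> ` R \<noteq> R"
  have xS: "x \<in> \<sigma> ` R"
  proof (rule ccontr)
    assume "x \<notin> \<sigma> ` R"
    then have "Y2_infinity n m K x y (\<sigma> ` R)"
      by (intro infinity_ringI K_subset_image K_sub S.valuation_subring_axioms)
    then show False using ne infinity_unique Y2_infinity_axioms by blast
  qed
  \<comment> \<open>At a pole of \<open>y\<close>, \<open>x ^ (2 * m + 1)\<close> is a unit times
    \<open>y ^ m\<close>, so \<open>x\<close> would have a pole too.\<close>
  have yS: "y \<in> \<sigma> ` R"
  proof (rule ccontr)
    assume "y \<notin> \<sigma> ` R"
    from h_eq_power_times_unit[OF S.valuation_subring_axioms this]
    obtain v where v: "S.unit v" "x ^ (2 * m + 1) = y ^ m * v" unfolding h_y .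
    then have "y ^ m = x ^ (2 * m + 1) * inverse v" by (simp add: S.unit_def)
    also have "\<dots> \<in> \<sigma> ` R"
      using v(1) by (intro subring_mult[OF S.subring] subring_power[OF S.subring] xS)
        (simp add: S.unit_def)
    finally show False using S.power_mem[of m y] m2 \<open>y \<notin> \<sigma> ` R\<close> by simp
  qed
  obtain a where a: "a \<in> K" "x + a \<in> S.mx" using residue_S[OF xS] by auto
  obtain b where b: "b \<in> K" "y + b \<in> S.mx" using residue_S[OF yS] by auto
  have aS: "a \<in> \<sigma> ` R" using a K_subset_image[OF K_sub] by auto
  \<comment> \<open>The defining equation reduced at the image place: the residues \<open>a\<close>,
    \<open>b\<close> satisfy it up to a constant lying in \<open>S.mx\<close>.\<close>
  have "Y2_h n b + a ^ (2 * m + 1) \<in> S.mx"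
  proof -
    have "Y2_h n (y + b) \<in> S.mx"
      unfolding Y2_h_def using b(2) by (intro S.mx_sum S.mx_power) auto
    moreover have "(x + a) ^ (2 * m) * x + (x + a) * a ^ (2 * m) \<in> S.mx"
      using a xS aS m2 S.mx_mult[of x "(x + a) ^ (2 * m)"] S.mx_mult[of "a ^ (2 * m)" "x + a"]
      by (intro S.mx_add) (simp_all add: mult.commute S.mx_power subring_power[OF S.subring])
    ultimately have "Y2_h n (y + b) + ((x + a) ^ (2 * m) * x + (x + a) * a ^ (2 * m)) \<in> S.mx"
      by (rule S.mx_add)
    also have "(x + a) ^ (2 * m) = x ^ (2 * m) + a ^ (2 * m)"
      using add_power_two_power[OF two, of x a n] by (simp only: two_power_n)
    also have "Y2_h n (y + b) + ((x ^ (2 * m) + a ^ (2 * m)) * x + (x + a) * a ^ (2 * m))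
        = (Y2_h n b + a ^ (2 * m + 1)) + (Y2_h n y + x ^ (2 * m + 1))
          + (a ^ (2 * m) * x + a ^ (2 * m) * x)"
      by (simp add: h_add algebra_simps)
    finally show ?thesis by (simp only: h_y add_self add_0_right)
  qed
  moreover have "Y2_h n b + a ^ (2 * m + 1) \<in> K"
    unfolding Y2_h_def using a b by (intro K_closed)
  ultimately have "Y2_h n b + a ^ (2 * m + 1) = 0" using K_mx_S by blast
  then have hb: "Y2_h n b = a ^ (2 * m + 1)"
    by (metis eq_neg_iff_add_eq_0 uminus_eq)
  define y' where "y' = y + b + ((a ^ (2 * m) * (x + a))\<^sup>2 + a ^ (2 * m) * (x + a))"
  interpret T: Y2_field n m K "x + a" y'
    unfolding y'_def by (rule translate[OF a(1) b(1) hb])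
  interpret T: Y2_automorphism n m K "x + a" y' R \<sigma>
  proof
    show "K \<subseteq> R" by (rule K_sub)
    show "x + a \<notin> R"
    proof
      assume "x + a \<in> R"
      then have "x + a - a \<in> R" using a K_sub by (intro subring_diff[OF subring]) auto
      then show False using x_pole by simp
    qed
  qed
  have "a ^ (2 * m) * (x + a) \<in> S.mx"
    using a(2) aS by (intro S.mx_mult subring_power[OF S.subring])
  then have "y' \<in> S.mx"
    unfolding y'_def by (intro S.mx_add[OF b(2)] S.mx_add[OF S.mx_power]) simp_all
  then show False using T.not_origin a(2) by blast
qed

end

theorem theorem3p7:
  fixes n q :: nat
    and K :: "'a::field set"
    and x y :: 'a
    and P_inf :: "'a set"
  assumes "n \<ge> 2" and "q = 2 ^ n"
    and "is_subfield K" and "card K = q\<^sup>2"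
    and "is_Y2 n K x y"
    and "is_place K P_inf" and "is_pole_of K P_inf x" and "is_pole_of K P_inf y"
  shows "field_aut K = place_stabilizer K P_inf"
proof -
  obtain R where R: "is_valuation_ring K R" "is_maximal_ideal_of R P_inf" "x \<notin> R"
    using assms(7) by (auto simp: is_pole_of_def)
  interpret valuation_subring R by (rule valuation_subring_of[OF R(1)])
  have q: "2 ^ n = 2 * 2 ^ (n - 1)" using assms(1) by (cases n) auto
  interpret Y2_infinity n "2 ^ (n - 1)" K x y R
  proof
    show "Y2_h n y = x ^ (2 * 2 ^ (n - 1) + 1)" "field_adjoin K {x, y} = UNIV"
      using assms(5) unfolding is_Y2_def q by auto
    show "K \<subseteq> R" using R(1) by (auto simp: is_valuation_ring_def)
  qed (use assms R in auto)
  have P: "P_inf = mx" by (rule maximal_ideal_eq_mx[OF R(2)])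
  have "\<sigma> ` P_inf = P_inf" if "\<sigma> \<in> field_aut K" for \<sigma>
  proof -
    interpret Y2_automorphism n "2 ^ (n - 1)" K x y R \<sigma>
      by unfold_locales (rule that)
    have "\<sigma> a \<in> mx \<longleftrightarrow> a \<in> mx" for a
      using mx_image[OF valuation_subring_axioms, of a] by (simp add: image_infinity)
    then show ?thesis unfolding P using surj by (metis image_iff subset_antisym subsetI)
  qed
  then show ?thesis by (auto simp: place_stabilizer_def)
qed

end
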